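(* For all positive integers $n$ and $s$ and every even positive integer $m=2k$, $$N(SO(2n),m,s)=\binom{n-1}{s-1}\left[\binom{m/2+1}{s}+\binom{m/2-1}{s}\right].$$
   Context: $SO(2n)$ is the group of real $2n\times 2n$ orthogonal matrices of determinant $1$. For real $\theta$ let $A(\theta)=\begin{pmatrix}\cos 2\pi\theta & \sin 2\pi\theta\\ -\sin 2\pi\theta & \cos2\pi\theta\end{pmatrix}$. Every element of $SO(2n)$ is conjugate in $SO(2n)$ to $\mathrm{diag}(A(\theta_1),\dots,A(\theta_n))$; replacing each $\theta_l$ by the unique number in $[0,1/2]$ congruent to $\pm\theta_l$ modulo $1$, the number of distinct conjugate pairs of eigenvalues of the element is the number of distinct values among $\theta_1,\dots,\theta_n$. $N(SO(2n),m,s)$ denotes the number of conjugacy classes of $SO(2n)$ (under conjugation by $SO(2n)$) consisting of elements $x$ with $x^m=1$ having exactly $s$ distinct conjugate pairs of eigenvalues. *)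

theory Defs
  imports
    "HOL-Analysis.Analysis"
    "HOL-Algebra.Group_Action"
    "Jordan_Normal_Form.Spectral_Radius"
begin

definition SO :: "nat \<Rightarrow> real mat monoid" where
  "SO d = \<lparr>carrier = {A \<in> carrier_mat d d. A * transpose_mat A = 1\<^sub>m d \<and> Determinant.det A = 1},
           monoid.mult = (*), one = 1\<^sub>m d\<rparr>"

definition conj_classes :: "('a, 'b) monoid_scheme \<Rightarrow> 'a set set" where
  "conj_classes G =
     orbits G (carrier G) (\<lambda>g. \<lambda>h\<in>carrier G. g \<otimes>\<^bsub>G\<^esub> h \<otimes>\<^bsub>G\<^esub> inv\<^bsub>G\<^esub> g)"

text \<open>A real eigenvalue \<open>z\<close> contributes the degenerate pair \<open>{z, z}\<close>.  On \<open>SO(2n)\<close> the real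
  eigenvalues \<open>1\<close> and \<open>-1\<close> have even multiplicity and belong to the angles \<open>0\<close> and \<open>1/2\<close>;
  see \<open>card_conj_eigenpairs\<close> below.\<close>

definition conj_eigenpairs :: "real mat \<Rightarrow> complex set set" where
  "conj_eigenpairs A = (\<lambda>z. {z, cnj z}) ` spectrum (map_mat complex_of_real A)"

definition SO_torsion_classes :: "nat \<Rightarrow> nat \<Rightarrow> nat \<Rightarrow> real mat set set" where
  "SO_torsion_classes n m s =
     {C \<in> conj_classes (SO (2 * n)).
        \<forall>x\<in>C. x [^]\<^bsub>SO (2 * n)\<^esub> m = \<one>\<^bsub>SO (2 * n)\<^esub> \<and> card (conj_eigenpairs x) = s}"

definition N_SO :: "nat \<Rightarrow> nat \<Rightarrow> nat \<Rightarrow> nat" where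
  "N_SO n m s = card (SO_torsion_classes n m s)"

lemma SO_carrier_iff:
  "A \<in> carrier (SO d) \<longleftrightarrow>
     A \<in> carrier_mat d d \<and> A * transpose_mat A = 1\<^sub>m d \<and> Determinant.det A = 1"
  by (simp add: SO_def)

lemma SO_transpose_mult:
  assumes "A \<in> carrier (SO d)"
  shows "transpose_mat A * A = 1\<^sub>m d"
  using assms mat_mult_left_right_inverse[of A d "transpose_mat A"]
  by (auto simp: SO_carrier_iff)

lemma SO_transpose_closed:
  assumes "A \<in> carrier (SO d)"
  shows "transpose_mat A \<in> carrier (SO d)"
  using assms SO_transpose_mult[OF assms] Determinant.det_transpose[of A d]
  by (auto simp: SO_carrier_iff)

lemma group_SO: "group (SO d)"
proof (rule groupI)
  fix x y assume x: "x \<in> carrier (SO d)" and y: "y \<in> carrier (SO d)"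
  have xc: "x \<in> carrier_mat d d" and yc: "y \<in> carrier_mat d d"
    using x y by (auto simp: SO_carrier_iff)
  have "(x * y) * transpose_mat (x * y) = x * (y * transpose_mat y) * transpose_mat x"
    using xc yc by (simp add: transpose_mult[OF xc yc] assoc_mult_mat[of _ d d _ d _ d])
  also have "\<dots> = 1\<^sub>m d"
    using x y xc right_mult_one_mat[OF xc] by (simp add: SO_carrier_iff)
  finally have "(x * y) * transpose_mat (x * y) = 1\<^sub>m d" .
  moreover have "Determinant.det (x * y) = 1"
    using x y by (simp add: SO_carrier_iff Determinant.det_mult[OF xc yc])
  ultimately show "x \<otimes>\<^bsub>SO d\<^esub> y \<in> carrier (SO d)"
    using xc yc by (simp add: SO_def)
next
  show "\<one>\<^bsub>SO d\<^esub> \<in> carrier (SO d)"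
    by (simp add: SO_def)
next
  fix x y z assume "x \<in> carrier (SO d)" "y \<in> carrier (SO d)" "z \<in> carrier (SO d)"
  then show "x \<otimes>\<^bsub>SO d\<^esub> y \<otimes>\<^bsub>SO d\<^esub> z = x \<otimes>\<^bsub>SO d\<^esub> (y \<otimes>\<^bsub>SO d\<^esub> z)"
    by (simp add: SO_def assoc_mult_mat[of _ d d _ d _ d])
next
  fix x assume x: "x \<in> carrier (SO d)"
  then show "\<one>\<^bsub>SO d\<^esub> \<otimes>\<^bsub>SO d\<^esub> x = x"
    using left_mult_one_mat[of x d d] by (simp add: SO_def)
  show "\<exists>y\<in>carrier (SO d). y \<otimes>\<^bsub>SO d\<^esub> x = \<one>\<^bsub>SO d\<^esub>"
    by (rule bexI[OF _ SO_transpose_closed[OF x]]) (use SO_transpose_mult[OF x] in \<open>simp add: SO_def\<close>)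
qed

lemma SO_inv:
  assumes "A \<in> carrier (SO d)"
  shows "inv\<^bsub>SO d\<^esub> A = transpose_mat A"
  using SO_transpose_mult[OF assms] SO_transpose_closed[OF assms] assms
  by (intro group.inv_equality[OF group_SO]) (auto simp: SO_def)

definition rot_block :: "real \<Rightarrow> real mat" where
  "rot_block t = mat_of_rows_list 2
     [[cos (2 * pi * t), sin (2 * pi * t)], [- sin (2 * pi * t), cos (2 * pi * t)]]"

definition block_rotation :: "real list \<Rightarrow> real mat" where
  "block_rotation ts = diag_block_mat (map rot_block ts)"

definition folded_angle :: "real \<Rightarrow> real" where
  "folded_angle t = (THE u. 0 \<le> u \<and> u \<le> 1/2 \<and> (u - t \<in> \<int> \<or> u + t \<in> \<int>))"

lemma folded_angle_props:
  "0 \<le> folded_angle t" "folded_angle t \<le> 1/2"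
  "folded_angle t - t \<in> \<int> \<or> folded_angle t + t \<in> \<int>"
proof -
  let ?P = "\<lambda>u. 0 \<le> u \<and> u \<le> 1/2 \<and> (u - t \<in> \<int> \<or> u + t \<in> \<int>)"
  have "\<exists>!u. ?P u"
  proof (rule ex_ex1I)
    show "\<exists>u. ?P u"
    proof (cases "frac t \<le> 1/2")
      case True
      have "frac t - t \<in> \<int>" by (simp add: frac_def)
      with True show ?thesis by (intro exI[of _ "frac t"]) auto
    next
      case False
      have "(1 - frac t) + t \<in> \<int>" by (simp add: frac_def)
      with False frac_lt_1[of t] show ?thesis by (intro exI[of _ "1 - frac t"]) auto
    qed
  next
    fix u v assume u: "?P u" and v: "?P v"
    have "u - v \<in> \<int> \<or> u + v \<in> \<int>"
    proof -
      have "u - v = (u - t) - (v - t)" "u - v = (u + t) - (v + t)"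
        "u + v = (u - t) + (v + t)" "u + v = (u + t) + (v - t)" by auto
      with u v show ?thesis by (metis Ints_add Ints_diff)
    qed
    then obtain k :: int where k: "u - v = of_int k \<or> u + v = of_int k"
      by (auto elim: Ints_cases)
    from k show "u = v"
    proof
      assume e: "u - v = of_int k"
      then have "of_int k < (1::real)" "of_int k > (-1::real)" using u v by linarith+
      then have "k = 0" by linarith
      with e show ?thesis by simp
    next
      assume e: "u + v = of_int k"
      then have "of_int k \<le> (1::real)" "of_int k \<ge> (0::real)" using u v by linarith+
      then have "k = 0 \<or> k = 1" by linarith
      with e u v show ?thesis by auto
    qed
  qed
  from theI'[OF this]
  show "0 \<le> folded_angle t" "folded_angle t \<le> 1/2"
    "folded_angle t - t \<in> \<int> \<or> folded_angle t + t \<in> \<int>"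
    unfolding folded_angle_def by auto
qed

lemma cos_folded_angle: "cos (2 * pi * folded_angle t) = cos (2 * pi * t)"
proof -
  obtain k :: int where "folded_angle t - t = of_int k \<or> folded_angle t + t = of_int k"
    using folded_angle_props(3)[of t] Ints_cases by metis
  then have "folded_angle t = t + of_int k \<or> folded_angle t = of_int k - t"
    by linarith
  then have "2 * pi * folded_angle t = 2 * pi * t + 2 * pi * of_int k \<or>
             2 * pi * folded_angle t = - (2 * pi * t) + 2 * pi * of_int k"
    by (elim disjE) (simp_all add: right_diff_distrib distrib_left)
  then show ?thesis
    by (elim disjE) (simp_all only: cos_add sin_int_2pin cos_int_2pin, simp_all)
qed

lemma det_mat_2x2:
  fixes A :: "'a :: comm_ring_1 mat"
  assumes "A \<in> carrier_mat 2 2"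
  shows "Determinant.det A = A $$ (0,0) * A $$ (1,1) - A $$ (0,1) * A $$ (1,0)"
proof -
  have 1: "Determinant.det B = B $$ (0,0)" if "B \<in> carrier_mat 1 1" for B :: "'a mat"
    using that by (simp add: det_single)
  have c: "mat_delete A i 0 \<in> carrier_mat 1 1" for i
    using mat_delete_carrier[of A 2 2] assms by simp
  show ?thesis
    using assms laplace_expansion_column[OF assms, of 0] 1[OF c[of 0]] 1[OF c[of 1]]
    by (simp add: cofactor_def numeral_2_eq_2 mat_delete_def algebra_simps)
qed

lemma rot_block_carrier [simp]: "rot_block t \<in> carrier_mat 2 2"
  by (simp add: rot_block_def mat_of_rows_list_def numeral_2_eq_2)

lemma block_rotation_carrier:
  "block_rotation ts \<in> carrier_mat (2 * length ts) (2 * length ts)"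
proof -
  have "dim_row (rot_block t) = 2 \<and> dim_col (rot_block t) = 2" for t
    using rot_block_carrier[of t] by (simp only: carrier_mat_def mem_Collect_eq)
  then show ?thesis
    unfolding block_rotation_def carrier_mat_def
    by (auto simp: dim_diag_block_mat o_def sum_list_triv)
qed

lemma eigenvalue_rot_block:
  "Determinant.det (char_matrix (map_mat complex_of_real (rot_block t)) z) = 0 \<longleftrightarrow>
     z = cis (2 * pi * t) \<or> z = cnj (cis (2 * pi * t))"
proof -
  let ?w = "cis (2 * pi * t)"
  have c: "char_matrix (map_mat complex_of_real (rot_block t)) z \<in> carrier_mat 2 2"
    by simp
  have w: "?w + cnj ?w = 2 * of_real (cos (2 * pi * t))" "?w * cnj ?w = 1"
    by (auto simp: complex_eq_iff cis_cnj cis_mult)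
  have sc: "complex_of_real (cos (2*pi*t)) ^ 2 + complex_of_real (sin (2*pi*t)) ^ 2 = 1"
    by (metis of_real_1 of_real_add of_real_power sin_cos_squared_add2)
  have "Determinant.det (char_matrix (map_mat complex_of_real (rot_block t)) z) =
        (of_real (cos (2*pi*t)) - z) ^ 2 + of_real (sin (2*pi*t)) ^ 2"
    unfolding det_mat_2x2[OF c]
    by (simp add: char_matrix_def rot_block_def mat_of_rows_list_def power2_eq_square)
  also have "\<dots> = z ^ 2 - 2 * of_real (cos (2*pi*t)) * z + 1"
    using sc by (simp add: power2_eq_square algebra_simps)
  also have "\<dots> = (z - ?w) * (z - cnj ?w)"
    unfolding w(1)[symmetric] w(2)[symmetric] by (simp add: power2_eq_square algebra_simps)
  finally show ?thesis by simp
qed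

lemma char_matrix_block_diag:
  assumes "A \<in> carrier_mat a a" "B \<in> carrier_mat b b"
  shows "char_matrix (four_block_mat A (0\<^sub>m a b) (0\<^sub>m b a) B) z =
         four_block_mat (char_matrix A z) (0\<^sub>m a b) (0\<^sub>m b a) (char_matrix B z)"
  using assms by (intro eq_matI) (auto simp: char_matrix_def)

lemma spectrum_block_rotation:
  "spectrum (map_mat complex_of_real (block_rotation ts)) =
     (\<Union>t\<in>set ts. {cis (2 * pi * t), cnj (cis (2 * pi * t))})"
proof -
  have "Determinant.det (char_matrix (map_mat complex_of_real (block_rotation ts)) z) = 0 \<longleftrightarrow>
        (\<exists>t\<in>set ts. z = cis (2 * pi * t) \<or> z = cnj (cis (2 * pi * t)))" for z
  proof (induction ts)
    case Nil
    have "char_matrix (map_mat complex_of_real (block_rotation [])) z \<in> carrier_mat 0 0"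
      by (simp add: block_rotation_def)
    then show ?case by simp
  next
    case (Cons t ts)
    let ?l = "2 * length ts"
    let ?A = "map_mat complex_of_real (rot_block t)"
    let ?B = "map_mat complex_of_real (block_rotation ts)"
    have A: "?A \<in> carrier_mat 2 2" and B: "?B \<in> carrier_mat ?l ?l"
      using block_rotation_carrier[of ts] by auto
    have d: "dim_row (rot_block t) = 2" "dim_col (rot_block t) = 2"
      "dim_row (block_rotation ts) = ?l" "dim_col (block_rotation ts) = ?l"
      using carrier_matD[OF rot_block_carrier[of t]] carrier_matD[OF block_rotation_carrier[of ts]]
      by simp_all
    have "block_rotation (t # ts) =
          four_block_mat (rot_block t) (0\<^sub>m 2 ?l) (0\<^sub>m ?l 2) (block_rotation ts)"
      using d by (simp add: block_rotation_def Let_def)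
    then have "map_mat complex_of_real (block_rotation (t # ts)) =
          four_block_mat ?A (0\<^sub>m 2 ?l) (0\<^sub>m ?l 2) ?B"
      using d by (intro eq_matI) auto
    then have "Determinant.det (char_matrix (map_mat complex_of_real (block_rotation (t # ts))) z) =
          Determinant.det (char_matrix ?A z) * Determinant.det (char_matrix ?B z)"
      by (simp only: char_matrix_block_diag[OF A B])
        (rule det_four_block_mat_lower_left_zero[of _ 2 _ ?l], use A B in auto)
    then show ?case
      using Cons.IH eigenvalue_rot_block[of t z] by auto
  qed
  then show ?thesis
    using block_rotation_carrier[of ts]
    by (auto simp: spectrum_def eigenvalue_det[of _ "2 * length ts"])
qed

lemma conj_eigenpairs_conjugate:
  assumes g: "g \<in> carrier (SO d)" and A: "A \<in> carrier_mat d d"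
  shows "conj_eigenpairs (g \<otimes>\<^bsub>SO d\<^esub> A \<otimes>\<^bsub>SO d\<^esub> inv\<^bsub>SO d\<^esub> g) = conj_eigenpairs A"
proof -
  let ?c = "map_mat complex_of_real"
  let ?x = "g * A * transpose_mat g"
  have gc: "g \<in> carrier_mat d d" "g * transpose_mat g = 1\<^sub>m d" "transpose_mat g * g = 1\<^sub>m d"
    using g SO_transpose_mult[OF g] by (auto simp: SO_carrier_iff)
  have xc: "?x \<in> carrier_mat d d" using gc A by simp
  have "similar_mat ?x A"
    by (rule similar_matI[of _ _ g "transpose_mat g" d]) (use gc A in auto)
  then have "char_poly ?x = char_poly A" by (rule char_poly_similar)
  then have "char_poly (?c ?x) = char_poly (?c A)"
    using of_real_hom.char_poly_hom[OF xc, where ?'a = complex]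
      of_real_hom.char_poly_hom[OF A, where ?'a = complex] by simp
  moreover have "?c ?x \<in> carrier_mat d d" "?c A \<in> carrier_mat d d" using xc A by auto
  ultimately have "spectrum (?c ?x) = spectrum (?c A)"
    by (simp add: spectrum_root_char_poly[of _ d])
  then show ?thesis
    using SO_inv[OF g] by (simp add: conj_eigenpairs_def SO_def)
qed

text \<open>The number of conjugate pairs of eigenvalues is the number of distinct values among the
  angles, once these are folded into \<open>[0, 1/2]\<close>.\<close>

lemma card_conj_eigenpairs:
  assumes "g \<in> carrier (SO (2 * length ts))"
  shows "card (conj_eigenpairs
           (g \<otimes>\<^bsub>SO (2 * length ts)\<^esub> block_rotation ts \<otimes>\<^bsub>SO (2 * length ts)\<^esub> inv\<^bsub>SO (2 * length ts)\<^esub> g))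
         = card (folded_angle ` set ts)"
proof -
  let ?p = "\<lambda>z. {z, cnj z}"
  let ?q = "\<lambda>t. ?p (cis (2 * pi * t))"
  have Re_eq: "cos (2 * pi * t) = cos (2 * pi * u)" if "?q t = ?q u" for t u
  proof -
    from that have "cis (2 * pi * t) = cis (2 * pi * u) \<or> cis (2 * pi * t) = cnj (cis (2 * pi * u))"
      by (auto simp: doubleton_eq_iff)
    then show ?thesis by (auto simp: complex_eq_iff)
  qed
  have q_fold: "?q (folded_angle t) = ?q t" for t
  proof -
    have "sin (2 * pi * folded_angle t) ^ 2 = sin (2 * pi * t) ^ 2"
      using cos_folded_angle[of t] by (simp add: sin_squared_eq)
    then have "sin (2 * pi * folded_angle t) = sin (2 * pi * t) \<or>
               sin (2 * pi * folded_angle t) = - sin (2 * pi * t)"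
      by (simp add: power2_eq_iff)
    then have "cis (2 * pi * folded_angle t) = cis (2 * pi * t) \<or>
               cis (2 * pi * folded_angle t) = cnj (cis (2 * pi * t))"
      using cos_folded_angle[of t] by (auto simp: complex_eq_iff)
    then show ?thesis by auto
  qed
  have "conj_eigenpairs (block_rotation ts) = ?q ` set ts"
    unfolding conj_eigenpairs_def spectrum_block_rotation by (auto simp: insert_commute)
  also have "\<dots> = ?q ` folded_angle ` set ts"
    by (simp only: image_image q_fold)
  finally have "card (conj_eigenpairs (block_rotation ts)) = card (?q ` folded_angle ` set ts)"
    by simp
  also have "\<dots> = card (folded_angle ` set ts)"
  proof (rule card_image, rule inj_onI)
    fix u v assume "u \<in> folded_angle ` set ts" "v \<in> folded_angle ` set ts" and e: "?q u = ?q v"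
    then have "0 \<le> u" "u \<le> 1/2" "0 \<le> v" "v \<le> 1/2"
      using folded_angle_props by auto
    then have "0 \<le> 2 * pi * u" "2 * pi * u \<le> pi" "0 \<le> 2 * pi * v" "2 * pi * v \<le> pi"
      by auto
    from cos_inj_pi[OF this Re_eq[OF e]] show "u = v" by simp
  qed
  finally show ?thesis
    using conj_eigenpairs_conjugate[OF assms block_rotation_carrier] by simp
qed

end

theory Submission
  imports Defs
begin

unbundle no inner_syntax and no vec_syntax

text \<open>Every eigenvalue of \<open>A \<in> SO(2n)\<close> yields an invariant plane on which \<open>A\<close> rotates (the eigenspaces
  of \<open>1\<close> and \<open>-1\<close> have even dimension), so \<open>A\<close> is conjugate under \<open>O(2n)\<close> to a block rotation, and the multiset of its
  angles in \<open>[0, 1/2]\<close> is read off from the characteristic polynomial.  An \<open>O(2n)\<close>-class inside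
  \<open>SO(2n)\<close> is a single \<open>SO(2n)\<close>-class if some reflection commutes with its elements, which happens
  when \<open>0\<close> or \<open>1/2\<close> is an angle; otherwise the centralizer preserves a complex structure, hence has
  determinant \<open>1\<close>, and the class splits in two.  The elements with \<open>x\<^sup>m = 1\<close> have angles in
  \<open>{j/m | 0 \<le> j \<le> m/2}\<close>, so the count is the number of multisets of size \<open>n\<close> with \<open>s\<close> distinct
  elements drawn from these \<open>m/2 + 1\<close> angles, plus the number of those avoiding \<open>0\<close> and \<open>1/2\<close>.\<close>

subsection \<open>Orthogonal matrices and Householder reflections\<close>

text \<open>Only conjugators of determinant 1 count, so a sign has to be controlled along with each
  normal form. Householder reflections do most of this: they extend orthonormal vectors to an
  orthogonal matrix, supply elements of determinant -1, and show that an eigenvalue 1 or -1 of an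
  element of SO(2n) is never simple. The delicate point is the centralizer of a block rotation R
  with repeated angles, which is larger than a torus. Grouping the planes by equal angles is avoided
  by looking at R - R^T = D J, where J is a quarter turn in every plane and D is diagonal with
  entries 2 sin(2 pi t), positive because 0 < t < 1/2. Whatever commutes with R commutes with R^T =
  R^-1, hence with D J, with its square -D^2, by positivity with D, and finally with J. That
  commuting with J forces a nonnegative determinant is derived without complex vector spaces, from
  the factorization A^2 + B^2 = (A + iB)(A - iB) for commuting real A and B.\<close>

definition orth :: "nat \<Rightarrow> real mat set" where
  "orth d = {P \<in> carrier_mat d d. P * transpose_mat P = 1\<^sub>m d}"

lemma orthD:
  assumes "P \<in> orth d"
  shows "P \<in> carrier_mat d d" "transpose_mat P \<in> carrier_mat d d"
    "P * transpose_mat P = 1\<^sub>m d" "transpose_mat P * P = 1\<^sub>m d"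
  using assms mat_mult_left_right_inverse[of P d "transpose_mat P"] by (auto simp: orth_def)

lemma SO_iff_orth: "A \<in> carrier (SO d) \<longleftrightarrow> A \<in> orth d \<and> Determinant.det A = 1"
  by (auto simp: SO_carrier_iff orth_def)

lemma one_orth [simp]: "1\<^sub>m d \<in> orth d"
  by (simp add: orth_def)

lemma orth_transpose: "P \<in> orth d \<Longrightarrow> transpose_mat P \<in> orth d"
  using orthD(2,4) unfolding orth_def by auto

lemma orth_mult:
  assumes "P \<in> orth d" "Q \<in> orth d"
  shows "P * Q \<in> orth d"
proof -
  note c = orthD[OF assms(1)] orthD[OF assms(2)]
  have "(P * Q) * transpose_mat (P * Q) = P * Q * (transpose_mat Q * transpose_mat P)"
    by (simp add: transpose_mult[OF c(1) c(5)])
  also have "\<dots> = P * (Q * transpose_mat Q) * transpose_mat P"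
    unfolding assoc_mult_mat[OF c(1,5) mult_carrier_mat[OF c(6,2)]]
      assoc_mult_mat[OF c(5,6,2), symmetric]
    by (rule assoc_mult_mat[OF c(1) mult_carrier_mat[OF c(5,6)] c(2), symmetric])
  also have "\<dots> = 1\<^sub>m d" unfolding c(7) right_mult_one_mat[OF c(1)] by (rule c(3))
  finally show ?thesis using c by (simp add: orth_def)
qed

lemma det_orth:
  assumes "P \<in> orth d"
  shows "Determinant.det P = 1 \<or> Determinant.det P = -1"
proof -
  have "Determinant.det P * Determinant.det P = 1"
    using orthD[OF assms] Determinant.det_mult[of P d "transpose_mat P"] Determinant.det_transpose[of P d]
    by (simp add: Determinant.det_one)
  then show ?thesis by (metis square_eq_1_iff)
qed

lemma orth_cancel_vec:
  assumes "P \<in> orth d" "v \<in> carrier_vec d"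
  shows "transpose_mat P *\<^sub>v (P *\<^sub>v v) = v" "P *\<^sub>v (transpose_mat P *\<^sub>v v) = v"
proof -
  note c = orthD[OF assms(1)]
  show "transpose_mat P *\<^sub>v (P *\<^sub>v v) = v"
    using assoc_mult_mat_vec[OF c(2,1) assms(2)] c(4) assms(2) by simp
  show "P *\<^sub>v (transpose_mat P *\<^sub>v v) = v"
    using assoc_mult_mat_vec[OF c(1,2) assms(2)] c(3) assms(2) by simp
qed

lemma orth_scalar_prod:
  assumes P: "P \<in> orth d" and u: "u \<in> carrier_vec d" and v: "v \<in> carrier_vec d"
  shows "(P *\<^sub>v u) \<bullet> (P *\<^sub>v v) = u \<bullet> v"
proof -
  note c = orthD[OF P]
  have "(P *\<^sub>v u) \<bullet> (P *\<^sub>v v) = (transpose_mat P *\<^sub>v (P *\<^sub>v u)) \<bullet> v"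
    using transpose_vec_mult_scalar[of P d d v "P *\<^sub>v u"] c u v by simp
  also have "transpose_mat P *\<^sub>v (P *\<^sub>v u) = u"
    by (rule orth_cancel_vec(1)[OF P u])
  finally show ?thesis .
qed

lemma mult_unit_vec:
  fixes A :: "'a :: semiring_1 mat"
  assumes "A \<in> carrier_mat n d" "i < d"
  shows "A *\<^sub>v unit_vec d i = col A i"
  using assms by (intro eq_vecI) auto

lemma mat_eqI_mult_vec:
  fixes A :: "'a :: semiring_1 mat"
  assumes A: "A \<in> carrier_mat n d" and B: "B \<in> carrier_mat n d"
    and e: "\<And>v. v \<in> carrier_vec d \<Longrightarrow> A *\<^sub>v v = B *\<^sub>v v"
  shows "A = B"
proof (rule mat_col_eqI)
  fix i assume "i < dim_col B"
  then show "col A i = col B i"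
    using A B e[of "unit_vec d i"] mult_unit_vec[OF A, of i] mult_unit_vec[OF B, of i] by simp
qed (use A B in auto)

text \<open>The reflection in the hyperplane orthogonal to \<open>w\<close>. As division by zero
  yields 0, \<open>w = 0\<close> gives the identity matrix, so the reflection along
  \<open>x - y\<close> that exchanges \<open>x\<close> and \<open>y\<close> makes sense even if
  \<open>x = y\<close>.\<close>

definition householder :: "nat \<Rightarrow> real vec \<Rightarrow> real mat" where
  "householder d w = mat d d (\<lambda>(i, j). (if i = j then 1 else 0) - 2 / (w \<bullet> w) * (w $ i * w $ j))"

lemma householder_carrier [simp]: "householder d w \<in> carrier_mat d d"
  by (simp add: householder_def)

lemma householder_transpose: "transpose_mat (householder d w) = householder d w"
  by (auto simp: householder_def)

lemma householder_mult_vec: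
  assumes w: "w \<in> carrier_vec d" and v: "v \<in> carrier_vec d"
  shows "householder d w *\<^sub>v v = v - (2 * (w \<bullet> v) / (w \<bullet> w)) \<cdot>\<^sub>v w"
proof (rule eq_vecI)
  fix i assume "i < dim_vec (v - (2 * (w \<bullet> v) / (w \<bullet> w)) \<cdot>\<^sub>v w)"
  then have i: "i < d" using w by simp
  let ?c = "2 / (w \<bullet> w)"
  have "(householder d w *\<^sub>v v) $ i = (\<Sum>j = 0..<d. ((if i = j then 1 else 0) - ?c * (w $ i * w $ j)) * v $ j)"
    using i v by (simp add: householder_def scalar_prod_def)
  also have "\<dots> = (\<Sum>j = 0..<d. (if i = j then v $ j else 0) - (?c * w $ i) * (w $ j * v $ j))"
    by (intro sum.cong) (auto simp: algebra_simps)
  also have "\<dots> = v $ i - ?c * w $ i * (w \<bullet> v)"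
    proof -
    have "(\<Sum>j = 0..<d. (?c * w $ i) * (w $ j * v $ j)) = ?c * w $ i * (w \<bullet> v)"
      unfolding sum_distrib_left[symmetric] using v by (simp add: scalar_prod_def)
    then show ?thesis using i by (simp add: sum_subtractf)
  qed
  finally show "(householder d w *\<^sub>v v) $ i = (v - (2 * (w \<bullet> v) / (w \<bullet> w)) \<cdot>\<^sub>v w) $ i"
    using i v w by simp
qed (use w v in \<open>simp add: householder_def\<close>)

lemma householder_orth:
  assumes w: "w \<in> carrier_vec d"
  shows "householder d w \<in> orth d"
proof -
  let ?H = "householder d w"
  have "?H * ?H = 1\<^sub>m d"
  proof (rule mat_eqI_mult_vec[of _ d d])
    fix v :: "real vec" assume v: "v \<in> carrier_vec d"
    let ?c = "2 * (w \<bullet> v) / (w \<bullet> w)"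
    have h: "?H *\<^sub>v v \<in> carrier_vec d" using v by (intro mult_mat_vec_carrier[of _ d d]) simp_all
    have "w \<bullet> (?H *\<^sub>v v) = w \<bullet> v - ?c * (w \<bullet> w)"
      using w v by (simp add: householder_mult_vec scalar_prod_minus_distrib[of _ d])
    \<comment> \<open>If \<open>w \<bullet> w = 0\<close>, both sides are quotients by zero and
      vanish.\<close>
    then have "2 * (w \<bullet> (?H *\<^sub>v v)) / (w \<bullet> w) = - ?c"
      by (cases "w \<bullet> w = 0") (simp_all add: field_simps)
    then have "?H *\<^sub>v (?H *\<^sub>v v) = (v - ?c \<cdot>\<^sub>v w) - (- ?c) \<cdot>\<^sub>v w"
      using householder_mult_vec[OF w h] householder_mult_vec[OF w v] by simp
    also have "\<dots> = v" using w v by (intro eq_vecI) auto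
    finally show "?H * ?H *\<^sub>v v = 1\<^sub>m d *\<^sub>v v"
      using v assoc_mult_mat_vec[of ?H d d ?H d v] by simp
  qed (auto intro!: mult_carrier_mat[of _ d d])
  then show ?thesis by (simp add: orth_def householder_transpose)
qed

lemma scalar_prod_self_eq_0:
  fixes w :: "real vec"
  assumes w: "w \<in> carrier_vec d" and e: "w \<bullet> w = 0"
  shows "w = 0\<^sub>v d"
proof (rule eq_vecI)
  fix i assume "i < dim_vec (0\<^sub>v d :: real vec)"
  then have i: "i < d" by simp
  have "(\<Sum>j = 0..<d. w $ j * w $ j) = 0" using e w by (simp add: scalar_prod_def)
  then have "\<forall>j\<in>{0..<d}. w $ j * w $ j = 0"
    by (subst (asm) sum_nonneg_eq_0_iff) auto
  then show "w $ i = 0\<^sub>v d $ i" using i by auto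
qed (use w in simp)

text \<open>For vectors of equal length, \<open>(x - y) \<bullet> (x - y)\<close> is twice
  \<open>(x - y) \<bullet> x\<close>, so the coefficient in the reflection formula is 1 and exactly
  \<open>x - y\<close> is subtracted from \<open>x\<close>.\<close>

lemma householder_maps:
  assumes x: "x \<in> carrier_vec d" and y: "y \<in> carrier_vec d" and e: "x \<bullet> x = y \<bullet> y"
  shows "householder d (x - y) *\<^sub>v x = y"
proof -
  let ?w = "x - y"
  have w: "?w \<in> carrier_vec d" using x y by simp
  have ww: "?w \<bullet> ?w = 2 * (?w \<bullet> x)"
    using x y w e comm_scalar_prod[OF x y]
    by (simp add: scalar_prod_minus_distrib[of _ d] minus_scalar_prod_distrib[of _ d])
  have "2 * (?w \<bullet> x) / (?w \<bullet> ?w) = 1 \<or> ?w = 0\<^sub>v d"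
    using scalar_prod_self_eq_0[OF w] by (auto simp: ww)
  then have "(2 * (?w \<bullet> x) / (?w \<bullet> ?w)) \<cdot>\<^sub>v ?w = ?w" by (elim disjE) (simp_all, auto)
  then have "householder d ?w *\<^sub>v x = x - ?w"
    using householder_mult_vec[OF w x] by simp
  also have "\<dots> = y" using x y by (intro eq_vecI) auto
  finally show ?thesis .
qed

lemma householder_fixes:
  assumes w: "w \<in> carrier_vec d" and v: "v \<in> carrier_vec d" and o: "w \<bullet> v = 0"
  shows "householder d w *\<^sub>v v = v"
  unfolding householder_mult_vec[OF w v] o using v w by (intro eq_vecI) simp_all

text \<open>Two reflections replace Gram-Schmidt: \<open>H\<close> moves \<open>x\<close> to the
  first basis vector, then \<open>K\<close> moves \<open>H y\<close> to the second. \<open>K\<close>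
  leaves the first basis vector alone because both \<open>H y\<close> and the second basis vector
  are orthogonal to it. The inverse of \<open>K * H\<close> is the matrix sought.\<close>

lemma orth_completion:
  assumes x: "x \<in> carrier_vec d" "x \<bullet> x = 1" and y: "y \<in> carrier_vec d" "y \<bullet> y = 1"
    and xy: "x \<bullet> y = 0" and d: "2 \<le> d"
  obtains W where "W \<in> orth d" "W *\<^sub>v unit_vec d 0 = x" "W *\<^sub>v unit_vec d 1 = y"
proof -
  let ?e = "unit_vec d 0 :: real vec" and ?f = "unit_vec d 1 :: real vec"
  have ef: "?e \<bullet> ?e = 1" "?f \<bullet> ?f = 1" "?f \<bullet> ?e = 0" using d by auto
  define H where "H = householder d (x - ?e)"
  have H: "H \<in> orth d" unfolding H_def using x by (intro householder_orth) simp
  note Hc = orthD[OF H]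
  have Hx: "H *\<^sub>v x = ?e" unfolding H_def by (rule householder_maps) (use x ef in auto)
  define y' where "y' = H *\<^sub>v y"
  have y': "y' \<in> carrier_vec d" "y' \<bullet> y' = 1" "y' \<bullet> ?e = 0"
    using orth_scalar_prod[OF H y(1) y(1)] orth_scalar_prod[OF H y(1) x(1)] Hc y x xy
      comm_scalar_prod[OF x(1) y(1)] unfolding y'_def Hx by auto
  define K where "K = householder d (y' - ?f)"
  have w: "y' - ?f \<in> carrier_vec d" using y' by simp
  have K: "K \<in> orth d" unfolding K_def by (rule householder_orth[OF w])
  note Kc = orthD[OF K]
  have Ky: "K *\<^sub>v y' = ?f" unfolding K_def by (rule householder_maps) (use y' ef in auto)
  have Ke: "K *\<^sub>v ?e = ?e" unfolding K_def
    by (rule householder_fixes[OF w]) (use y' ef in \<open>auto simp: minus_scalar_prod_distrib[of _ d]\<close>)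
  have KH: "K * H \<in> orth d" by (rule orth_mult[OF K H])
  note KHc = orthD[OF KH]
  show thesis
  proof (rule that)
    show "transpose_mat (K * H) \<in> orth d" by (rule orth_transpose[OF KH])
    have "(K * H) *\<^sub>v x = ?e" using Kc Hc x Hx Ke by simp
    moreover have "transpose_mat (K * H) *\<^sub>v ((K * H) *\<^sub>v x) = x"
      by (rule orth_cancel_vec(1)[OF KH x(1)])
    ultimately show "transpose_mat (K * H) *\<^sub>v ?e = x" by simp
    have "(K * H) *\<^sub>v y = ?f" using Kc Hc y Ky y'_def by simp
    moreover have "transpose_mat (K * H) *\<^sub>v ((K * H) *\<^sub>v y) = y"
      by (rule orth_cancel_vec(1)[OF KH y(1)])
    ultimately show "transpose_mat (K * H) *\<^sub>v ?f = y" by simp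
  qed
qed

lemma orth_completion1:
  assumes x: "x \<in> carrier_vec d" "x \<bullet> x = 1" and d: "0 < d"
  obtains W where "W \<in> orth d" "W *\<^sub>v unit_vec d 0 = x"
proof -
  let ?e = "unit_vec d 0 :: real vec"
  have H: "householder d (?e - x) \<in> orth d" using x by (intro householder_orth) simp
  have "householder d (?e - x) *\<^sub>v ?e = x" by (rule householder_maps) (use x d in auto)
  with H show thesis by (rule that)
qed

text \<open>Used in two ways: to compute the determinant of one reflection only, and to see that the
  reflection in an eigenvector commutes with the matrix.\<close>

lemma conj_householder:
  assumes W: "W \<in> orth d" and w: "w \<in> carrier_vec d"
  shows "W * householder d w * transpose_mat W = householder d (W *\<^sub>v w)"
proof (rule mat_eqI_mult_vec[of _ d d])
  fix v :: "real vec" assume v: "v \<in> carrier_vec d"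
  note c = orthD[OF W]
  let ?u = "transpose_mat W *\<^sub>v v"
  have u: "?u \<in> carrier_vec d" by (rule mult_mat_vec_carrier[OF c(2) v])
  have Wu: "W *\<^sub>v ?u = v" by (rule orth_cancel_vec(2)[OF W v])
  have Ww: "W *\<^sub>v w \<in> carrier_vec d" using c w by simp
  have "W * householder d w * transpose_mat W *\<^sub>v v = W *\<^sub>v (householder d w *\<^sub>v ?u)"
    using assoc_mult_mat_vec[OF mult_carrier_mat[OF c(1) householder_carrier] c(2) v]
      assoc_mult_mat_vec[OF c(1) householder_carrier u] by simp
  also have "\<dots> = W *\<^sub>v ?u - (2 * (w \<bullet> ?u) / (w \<bullet> w)) \<cdot>\<^sub>v (W *\<^sub>v w)"
    unfolding householder_mult_vec[OF w u] using u w
    by (simp add: mult_minus_distrib_mat_vec[OF c(1)] mult_mat_vec[OF c(1)])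
  also have "\<dots> = householder d (W *\<^sub>v w) *\<^sub>v v"
    unfolding householder_mult_vec[OF Ww v]
    using orth_scalar_prod[OF W w u] orth_scalar_prod[OF W w w] Wu by simp
  finally show "W * householder d w * transpose_mat W *\<^sub>v v = householder d (W *\<^sub>v w) *\<^sub>v v" .
qed (use orthD(1,2)[OF W] in \<open>auto intro!: mult_carrier_mat[of _ d d]\<close>)

text \<open>Every such reflection is conjugate to the one in the first basis vector, which is
  diagonal with entries -1, 1, ..., 1.\<close>

lemma det_householder:
  assumes x: "x \<in> carrier_vec d" "x \<bullet> x = 1" and d: "0 < d"
  shows "Determinant.det (householder d x) = -1"
proof -
  let ?e = "unit_vec d 0 :: real vec"
  obtain W where W: "W \<in> orth d" "W *\<^sub>v ?e = x" by (rule orth_completion1[OF x d])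
  note c = orthD[OF W(1)]
  have ee: "?e \<bullet> ?e = 1" using d by simp
  have ut: "upper_triangular (householder d ?e)"
    by (auto simp: householder_def ee)
  have "Determinant.det (householder d ?e) = prod_list (diag_mat (householder d ?e))"
    by (rule det_upper_triangular[OF ut householder_carrier])
  also have "diag_mat (householder d ?e) = map (\<lambda>i. if i = 0 then -1 else 1) [0..<d]"
    by (auto simp: diag_mat_def householder_def ee)
  also have "\<dots> = -1 # map (\<lambda>_. 1 :: real) [Suc 0..<d]"
    using d by (simp add: upt_conv_Cons)
  also have "prod_list \<dots> = -1"
    by (simp add: map_replicate_const)
  finally have e: "Determinant.det (householder d ?e) = -1" .
  have "Determinant.det W * Determinant.det W = 1" using det_orth[OF W(1)] by auto
  then show ?thesis
    using conj_householder[OF W(1), of ?e] W(2) c e Determinant.det_transpose[OF c(1)]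
      Determinant.det_mult[of "W * householder d ?e" d "transpose_mat W"]
      Determinant.det_mult[of W d "householder d ?e"] by simp
qed

subsection \<open>Block sums and block rotations\<close>

text \<open>The sizes of the zero blocks are read off from the arguments, so
  \<open>diag_block_mat\<close> unfolds to this sum one block at a time and inductions over the list
  of angles stay free of explicit zero blocks.\<close>

definition dsum :: "'a :: zero mat \<Rightarrow> 'a mat \<Rightarrow> 'a mat" where
  "dsum A B = four_block_mat A (0\<^sub>m (dim_row A) (dim_col B)) (0\<^sub>m (dim_row B) (dim_col A)) B"

lemma dsum_carrier [intro]:
  "A \<in> carrier_mat a a \<Longrightarrow> B \<in> carrier_mat b b \<Longrightarrow> dsum A B \<in> carrier_mat (a + b) (a + b)"
  unfolding dsum_def by (auto intro: four_block_carrier_mat)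

lemma dsum_mult:
  fixes A B :: "'a :: semiring_1 mat"
  assumes "A \<in> carrier_mat a a" "B \<in> carrier_mat b b" "C \<in> carrier_mat a a" "D \<in> carrier_mat b b"
  shows "dsum A B * dsum C D = dsum (A * C) (B * D)"
proof -
  have d: "dim_row A = a" "dim_col A = a" "dim_row B = b" "dim_col B = b"
    "dim_row C = a" "dim_col C = a" "dim_row D = b" "dim_col D = b" using assms by auto
  have "dsum A B * dsum C D = four_block_mat (A * C + 0\<^sub>m a b * 0\<^sub>m b a) (A * 0\<^sub>m a b + 0\<^sub>m a b * D)
      (0\<^sub>m b a * C + B * 0\<^sub>m b a) (0\<^sub>m b a * 0\<^sub>m a b + B * D)"
    unfolding dsum_def d
    by (rule mult_four_block_mat[of _ a a _ b _ b]) (use assms in auto)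
  also have "\<dots> = dsum (A * C) (B * D)"
    unfolding dsum_def using assms by (auto intro!: cong_four_block_mat)
  finally show ?thesis .
qed

lemma dsum_transpose:
  assumes "A \<in> carrier_mat a a" "B \<in> carrier_mat b b"
  shows "transpose_mat (dsum A B) = dsum (transpose_mat A) (transpose_mat B)"
  unfolding dsum_def using assms by (subst transpose_four_block_mat[of _ a a _ b _ b]) auto

lemma dsum_one: "dsum (1\<^sub>m a) (1\<^sub>m b) = 1\<^sub>m (a + b)"
  by (simp add: dsum_def)

lemma dsum_inject:
  assumes "A \<in> carrier_mat a a" "B \<in> carrier_mat b b" "C \<in> carrier_mat a a" "D \<in> carrier_mat b b"
    and e: "dsum A B = dsum C D"
  shows "A = C" "B = D"
proof -
  have "dsum A B $$ (i, j) = dsum C D $$ (i, j)" for i j by (simp add: e)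
  note * = this[unfolded dsum_def]
  show "A = C"
  proof (rule eq_matI)
    fix i j assume "i < dim_row C" "j < dim_col C"
    then show "A $$ (i, j) = C $$ (i, j)" using *[of i j] assms by auto
  qed (use assms in auto)
  show "B = D"
  proof (rule eq_matI)
    fix i j assume "i < dim_row D" "j < dim_col D"
    then show "B $$ (i, j) = D $$ (i, j)" using *[of "i + a" "j + a"] assms by auto
  qed (use assms in auto)
qed

lemma det_dsum:
  fixes A B :: "'a :: idom mat"
  assumes "A \<in> carrier_mat a a" "B \<in> carrier_mat b b"
  shows "Determinant.det (dsum A B) = Determinant.det A * Determinant.det B"
  unfolding dsum_def using assms by (intro det_four_block_mat_lower_left_zero[of _ a _ b]) auto

lemma char_poly_dsum:
  fixes A B :: "'a :: idom mat"
  assumes "A \<in> carrier_mat a a" "B \<in> carrier_mat b b"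
  shows "char_poly (dsum A B) = char_poly A * char_poly B"
proof -
  have "char_poly_matrix (dsum A B) = dsum (char_poly_matrix A) (char_poly_matrix B)"
    unfolding dsum_def char_poly_matrix_def using assms
    by (intro eq_matI) auto
  then show ?thesis
    unfolding char_poly_def using assms by (simp add: det_dsum[of _ a _ b])
qed

lemma dsum_orth_iff:
  assumes A: "A \<in> carrier_mat a a" and B: "B \<in> carrier_mat b b"
  shows "dsum A B \<in> orth (a + b) \<longleftrightarrow> A \<in> orth a \<and> B \<in> orth b"
proof -
  have "dsum A B * transpose_mat (dsum A B) = dsum (A * transpose_mat A) (B * transpose_mat B)"
    using A B by (simp add: dsum_transpose[OF A B] dsum_mult[of _ a _ b])
  moreover have "dsum (A * transpose_mat A) (B * transpose_mat B) = dsum (1\<^sub>m a) (1\<^sub>m b) \<longleftrightarrow>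
      A * transpose_mat A = 1\<^sub>m a \<and> B * transpose_mat B = 1\<^sub>m b"
    using dsum_inject[of "A * transpose_mat A" a "B * transpose_mat B" b "1\<^sub>m a" "1\<^sub>m b"] A B
    by (auto intro!: mult_carrier_mat)
  ultimately show ?thesis
    using A B dsum_carrier[OF A B] by (simp add: orth_def dsum_one)
qed

lemma rot_block_dims [simp]: "dim_row (rot_block t) = 2" "dim_col (rot_block t) = 2"
  using carrier_matD[OF rot_block_carrier[of t]] by simp_all

lemma rot_block_index [simp]:
  "rot_block t $$ (0, 0) = cos (2 * pi * t)" "rot_block t $$ (0, Suc 0) = sin (2 * pi * t)"
  "rot_block t $$ (Suc 0, 0) = - sin (2 * pi * t)" "rot_block t $$ (Suc 0, Suc 0) = cos (2 * pi * t)"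
  by (simp_all add: rot_block_def mat_of_rows_list_def)

lemma block_rotation_Nil: "block_rotation [] = 1\<^sub>m 0"
  by (auto simp: block_rotation_def)

lemma block_rotation_Cons: "block_rotation (t # ts) = dsum (rot_block t) (block_rotation ts)"
  by (simp add: block_rotation_def dsum_def Let_def)

lemma mat_2x2_eqI:
  assumes "A \<in> carrier_mat 2 2" "B \<in> carrier_mat 2 2"
    and "A $$ (0, 0) = B $$ (0, 0)" "A $$ (0, Suc 0) = B $$ (0, Suc 0)"
    "A $$ (Suc 0, 0) = B $$ (Suc 0, 0)" "A $$ (Suc 0, Suc 0) = B $$ (Suc 0, Suc 0)"
  shows "A = B"
  using assms by (intro eq_matI) (auto simp: numeral_2_eq_2 less_Suc_eq)

lemma rot_block_mult: "rot_block t * rot_block u = rot_block (t + u)"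
  by (rule mat_2x2_eqI)
    (auto intro!: mult_carrier_mat[of _ 2 2]
      simp: scalar_prod_def numeral_2_eq_2 distrib_left cos_add sin_add)

lemma rot_block_transpose: "transpose_mat (rot_block t) = rot_block (- t)"
  by (rule mat_2x2_eqI) auto

lemma rot_block_0: "rot_block 0 = 1\<^sub>m 2"
  by (rule mat_2x2_eqI) auto

lemma rot_block_orth: "rot_block t \<in> orth 2"
  by (simp add: orth_def rot_block_transpose rot_block_mult rot_block_0)

lemma det_rot_block: "Determinant.det (rot_block t) = 1"
  by (simp add: det_mat_2x2[OF rot_block_carrier] flip: power2_eq_square)

lemma block_rotation_SO: "block_rotation ts \<in> carrier (SO (2 * length ts))"
proof (induction ts)
  case Nil
  then show ?case by (simp add: SO_iff_orth block_rotation_Nil)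
next
  case (Cons t ts)
  then show ?case
    using dsum_orth_iff[OF rot_block_carrier block_rotation_carrier, of t ts]
      det_dsum[OF rot_block_carrier block_rotation_carrier, of t ts]
    by (simp add: SO_iff_orth block_rotation_Cons rot_block_orth det_rot_block)
qed

text \<open>The real quadratic with roots \<open>cis (2 * pi * t)\<close> and its conjugate. It
  depends on \<open>t\<close> only through the cosine, hence only on the folded angle.\<close>

definition angle_poly :: "real \<Rightarrow> real poly" where
  "angle_poly t = [:1, - 2 * cos (2 * pi * t), 1:]"

lemma char_poly_rot_block: "char_poly (rot_block t) = angle_poly t"
  unfolding char_poly_def angle_poly_def
  by (subst det_mat_2x2)
    (auto simp: char_poly_matrix_def algebra_simps simp flip: power2_eq_square,
      simp add: sin_squared_eq power2_eq_square algebra_simps)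

lemma char_poly_block_rotation:
  "char_poly (block_rotation ts) = (\<Prod>t\<leftarrow>ts. angle_poly t)"
proof (induction ts)
  case Nil
  then show ?case by (simp add: block_rotation_Nil char_poly_def char_poly_matrix_def)
next
  case (Cons t ts)
  then show ?case
    using char_poly_dsum[OF rot_block_carrier block_rotation_carrier, of t ts]
    by (simp add: block_rotation_Cons char_poly_rot_block)
qed

lemma poly_angle_poly_complex:
  "poly (map_poly complex_of_real (angle_poly t)) z =
     (z - cis (2 * pi * t)) * (z - cnj (cis (2 * pi * t)))"
proof -
  let ?w = "cis (2 * pi * t)"
  have w: "2 * of_real (cos (2 * pi * t)) = ?w + cnj ?w" "1 = ?w * cnj ?w"
    by (auto simp: complex_eq_iff cis_cnj cis_mult)
  have "poly (map_poly complex_of_real (angle_poly t)) z = 1 - (2 * of_real (cos (2 * pi * t))) * z + z * z"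
    by (simp add: angle_poly_def map_poly_pCons algebra_simps)
  also have "\<dots> = (z - ?w) * (z - cnj ?w)" unfolding w(1) by (subst w(2)) (simp add: algebra_simps)
  finally show ?thesis .
qed

subsection \<open>Invariant planes\<close>

lemma normalize_vec:
  fixes v :: "real vec"
  assumes v: "v \<in> carrier_vec d" "v \<noteq> 0\<^sub>v d"
  obtains r where "r \<noteq> 0" "(r \<cdot>\<^sub>v v) \<bullet> (r \<cdot>\<^sub>v v) = 1"
proof -
  have "v \<bullet> v \<ge> 0" using v by (simp add: scalar_prod_def sum_nonneg)
  with scalar_prod_self_eq_0[OF v(1)] v(2) have p: "v \<bullet> v > 0" by fastforce
  define r where "r = 1 / sqrt (v \<bullet> v)"
  have "r * r * (v \<bullet> v) = 1" using p by (simp add: r_def)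
  then have "(r \<cdot>\<^sub>v v) \<bullet> (r \<cdot>\<^sub>v v) = 1" using v by simp
  moreover have "r \<noteq> 0" using p by (simp add: r_def)
  ultimately show thesis using that by blast
qed

text \<open>Since \<open>B - e = (-e) B (B - e)\<^sup>T\<close>, the determinant of \<open>B - e\<close> is its own negative.\<close>

lemma orth_det_neg_eigenvalue:
  assumes B: "B \<in> orth d" and det: "Determinant.det B = -1" and d: "even d" and e: "e = 1 \<or> e = -1"
  shows "eigenvalue B e"
proof -
  note c = orthD[OF B]
  let ?C = "char_matrix B e"
  have C: "?C \<in> carrier_mat d d" using c(1) by simp
  have ee: "e * e = 1" using e by auto
  have T: "transpose_mat ?C = transpose_mat B + (- e) \<cdot>\<^sub>m 1\<^sub>m d"
    using c(1) by (auto simp: char_matrix_def)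
  have "B * transpose_mat ?C = 1\<^sub>m d + (- e) \<cdot>\<^sub>m B"
    unfolding T using c by (simp add: mult_add_distrib_mat[OF c(1,2)] mult_smult_distrib[OF c(1) one_carrier_mat[of d]])
  then have "(- e) \<cdot>\<^sub>m (B * transpose_mat ?C) = ?C"
    using c(1) ee by (auto simp: char_matrix_def algebra_simps intro!: eq_matI)
  then have "Determinant.det ?C = Determinant.det ((- e) \<cdot>\<^sub>m (B * transpose_mat ?C))" by simp
  also have "\<dots> = (- e) ^ d * (Determinant.det B * Determinant.det ?C)"
    using c(1) C carrier_matD[OF C] Determinant.det_mult[of B d "transpose_mat ?C"] Determinant.det_transpose[OF C] by simp
  also have "\<dots> = - Determinant.det ?C"
    using d e det by auto
  finally have "Determinant.det ?C = 0" by simp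
  then show ?thesis using eigenvalue_det[OF c(1)] by simp
qed

text \<open>This is how the even multiplicity of 1 and -1 enters. Composing \<open>A\<close> with
  the reflection in \<open>x\<close> gives determinant -1, so in even dimension the product again
  has \<open>e\<close> as an eigenvalue. It sends \<open>x\<close> to \<open>- e\<close> times
  \<open>x\<close>, so its eigenvector for \<open>e\<close> is a new one; being orthogonal to
  \<open>x\<close>, it is fixed by the reflection and is an eigenvector of \<open>A\<close>
  itself.\<close>

lemma SO_second_real_eigenvector:
  assumes A: "A \<in> carrier (SO d)" and d: "even d" "0 < d" and e: "e = 1 \<or> e = -1"
    and x: "x \<in> carrier_vec d" "x \<bullet> x = 1" "A *\<^sub>v x = e \<cdot>\<^sub>v x"
  obtains y where "y \<in> carrier_vec d" "y \<bullet> y = 1" "x \<bullet> y = 0" "A *\<^sub>v y = e \<cdot>\<^sub>v y"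
proof -
  have Ao: "A \<in> orth d" and detA: "Determinant.det A = 1" using A by (auto simp: SO_iff_orth)
  note c = orthD[OF Ao]
  let ?H = "householder d x"
  let ?B = "A * ?H"
  have B: "?B \<in> orth d" by (rule orth_mult[OF Ao householder_orth[OF x(1)]])
  have "Determinant.det ?B = -1"
    using Determinant.det_mult[OF c(1) householder_carrier[of d x]] detA
      det_householder[OF x(1,2) d(2)] by simp
  then have "eigenvalue ?B e" by (rule orth_det_neg_eigenvalue[OF B _ d(1) e])
  then obtain z where z: "z \<in> carrier_vec d" "z \<noteq> 0\<^sub>v d" "?B *\<^sub>v z = e \<cdot>\<^sub>v z"
    using c(1) by (auto simp: eigenvalue_def eigenvector_def)
  have Hx: "?H *\<^sub>v x = (-1) \<cdot>\<^sub>v x"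
    unfolding householder_mult_vec[OF x(1) x(1)] using x by (intro eq_vecI) auto
  then have Bx: "?B *\<^sub>v x = (- e) \<cdot>\<^sub>v x"
    using assoc_mult_mat_vec[OF c(1) householder_carrier x(1), of x] mult_mat_vec[OF c(1) x(1)] x(3)
    unfolding Hx by (simp add: smult_smult_assoc)
  have ee: "e * e = 1" using e by auto
  \<comment> \<open>\<open>?B\<close> preserves scalar products and scales \<open>x\<close> and
    \<open>z\<close> by opposite signs.\<close>
  have "x \<bullet> z = (?B *\<^sub>v x) \<bullet> (?B *\<^sub>v z)" using orth_scalar_prod[OF B x(1) z(1)] by simp
  also have "\<dots> = - (e * e * (x \<bullet> z))" unfolding Bx z(3) using x z by simp
  finally have xz: "x \<bullet> z = 0" using ee by simp
  have "?H *\<^sub>v z = z" by (rule householder_fixes[OF x(1) z(1) xz])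
  then have Az: "A *\<^sub>v z = e \<cdot>\<^sub>v z"
    using z(3) assoc_mult_mat_vec[OF c(1) householder_carrier z(1), of x] by simp
  obtain r where r: "r \<noteq> 0" "(r \<cdot>\<^sub>v z) \<bullet> (r \<cdot>\<^sub>v z) = 1" by (rule normalize_vec[OF z(1,2)])
  show thesis
  proof (rule that[of "r \<cdot>\<^sub>v z"])
    show "A *\<^sub>v (r \<cdot>\<^sub>v z) = e \<cdot>\<^sub>v (r \<cdot>\<^sub>v z)"
      using mult_mat_vec[OF c(1) z(1)] Az by (simp add: smult_smult_assoc mult.commute)
  qed (use r z x xz in auto)
qed

lemma complex_eigenvector_parts:
  fixes A :: "real mat"
  assumes A: "A \<in> carrier_mat d d" and v: "v \<in> carrier_vec d"
    and e: "map_mat complex_of_real A *\<^sub>v v = z \<cdot>\<^sub>v v"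
  shows "A *\<^sub>v map_vec Re v = Re z \<cdot>\<^sub>v map_vec Re v - Im z \<cdot>\<^sub>v map_vec Im v"
    and "A *\<^sub>v map_vec Im v = Im z \<cdot>\<^sub>v map_vec Re v + Re z \<cdot>\<^sub>v map_vec Im v"
proof -
  have i: "(\<Sum>j = 0..<d. complex_of_real (A $$ (i, j)) * v $ j) = z * v $ i" if "i < d" for i
  proof -
    have "(map_mat complex_of_real A *\<^sub>v v) $ i = (z \<cdot>\<^sub>v v) $ i" by (simp add: e)
    then show ?thesis using A v that by (simp add: scalar_prod_def)
  qed
  have re: "(\<Sum>j = 0..<d. A $$ (i, j) * Re (v $ j)) = Re z * Re (v $ i) - Im z * Im (v $ i)" if "i < d" for i
    using arg_cong[OF i[OF that], of Re] by simp
  have im: "(\<Sum>j = 0..<d. A $$ (i, j) * Im (v $ j)) = Im z * Re (v $ i) + Re z * Im (v $ i)" if "i < d" for i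
    using arg_cong[OF i[OF that], of Im] by simp
  show "A *\<^sub>v map_vec Re v = Re z \<cdot>\<^sub>v map_vec Re v - Im z \<cdot>\<^sub>v map_vec Im v"
    using A v by (intro eq_vecI) (simp_all add: scalar_prod_def re)
  show "A *\<^sub>v map_vec Im v = Im z \<cdot>\<^sub>v map_vec Re v + Re z \<cdot>\<^sub>v map_vec Im v"
    using A v by (intro eq_vecI) (simp_all add: scalar_prod_def im)
qed

lemma scalar_prod_lincomb:
  fixes x y :: "real vec"
  assumes "x \<in> carrier_vec d" "y \<in> carrier_vec d"
  shows "(a \<cdot>\<^sub>v x + b \<cdot>\<^sub>v y) \<bullet> (p \<cdot>\<^sub>v x + q \<cdot>\<^sub>v y) =
    a * p * (x \<bullet> x) + (a * q + b * p) * (x \<bullet> y) + b * q * (y \<bullet> y)"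
  using assms comm_scalar_prod[OF assms]
  by (simp add: add_scalar_prod_distrib[of _ d] scalar_prod_add_distrib[of _ d] algebra_simps)

text \<open>For a real eigenvalue, the real and imaginary parts of a complex eigenvector satisfy the
  eigenvector equation separately, and they do not both vanish.\<close>

lemma real_eigenvector_of_complex:
  fixes A :: "real mat"
  assumes A: "A \<in> carrier_mat d d" and "eigenvalue (map_mat complex_of_real A) (of_real e)"
  obtains x where "x \<in> carrier_vec d" "x \<bullet> x = 1" "A *\<^sub>v x = e \<cdot>\<^sub>v x"
proof -
  obtain v where v: "v \<in> carrier_vec d" "v \<noteq> 0\<^sub>v d" "map_mat complex_of_real A *\<^sub>v v = of_real e \<cdot>\<^sub>v v"
    using assms by (auto simp: eigenvalue_def eigenvector_def)
  let ?a = "map_vec Re v" and ?b = "map_vec Im v"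
  have ab: "?a \<in> carrier_vec d" "?b \<in> carrier_vec d" using v by auto
  have "?a \<noteq> 0\<^sub>v d \<or> ?b \<noteq> 0\<^sub>v d"
  proof (rule ccontr)
    assume "\<not> ?thesis"
    then have "?a $ i = 0 \<and> ?b $ i = 0" if "i < d" for i using that by simp
    then have "v = 0\<^sub>v d" using v(1) by (intro eq_vecI) (auto simp: complex_eq_iff)
    with v(2) show False by simp
  qed
  moreover have "A *\<^sub>v ?a = e \<cdot>\<^sub>v ?a" "A *\<^sub>v ?b = e \<cdot>\<^sub>v ?b"
    using complex_eigenvector_parts[OF A v(1,3)] v(1) by auto
  ultimately obtain w where w: "w \<in> carrier_vec d" "w \<noteq> 0\<^sub>v d" "A *\<^sub>v w = e \<cdot>\<^sub>v w"
    using ab by blast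
  obtain r where r: "r \<noteq> 0" "(r \<cdot>\<^sub>v w) \<bullet> (r \<cdot>\<^sub>v w) = 1" by (rule normalize_vec[OF w(1,2)])
  show thesis
  proof (rule that[of "r \<cdot>\<^sub>v w"])
    show "A *\<^sub>v (r \<cdot>\<^sub>v w) = e \<cdot>\<^sub>v (r \<cdot>\<^sub>v w)"
      using mult_mat_vec[OF A w(1)] w by (simp add: smult_smult_assoc mult.commute)
  qed (use r w in auto)
qed

text \<open>Here \<open>X\<close>, \<open>Y\<close>, \<open>P\<close> stand for
  \<open>a \<bullet> a\<close>, \<open>b \<bullet> b\<close>, \<open>a \<bullet> b\<close>, where a
  + ib is an eigenvector of an orthogonal matrix for z = c + is. In the complex bilinear form, the
  square q = X - Y + 2iP of the eigenvector satisfies q = z^2 q, and z^2 differs from 1 because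
  \<open>s \<noteq> 0\<close>. The proof solves the resulting linear system in \<open>Y - X\<close>
  and \<open>2 * P\<close>, whose determinant is \<open>c * c + s * s\<close>.\<close>

lemma rotation_isotropic:
  fixes c s :: real
  assumes cs: "c * c + s * s = 1" and s: "s \<noteq> 0"
    and 1: "X = c * c * X + (c * - s + - s * c) * P + - s * - s * Y"
    and 2: "P = c * s * X + (c * c + - s * s) * P + - s * c * Y"
  shows "X = Y \<and> P = 0"
proof -
  have cc: "c * c = 1 - s * s" using cs by simp
  have "s * (s * (Y - X)) = s * (c * (2 * P))" using 1 unfolding cc by (simp add: algebra_simps)
  then have 3: "s * (Y - X) = c * (2 * P)" using s by simp
  have "s * (s * (2 * P)) = s * (- c * (Y - X))" using 2 unfolding cc by (simp add: algebra_simps)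
  then have 4: "s * (2 * P) = - c * (Y - X)" unfolding mult_left_cancel[OF s] .
  have "(c * c + s * s) * (Y - X) = c * (c * (Y - X)) + s * (s * (Y - X))" by (simp add: algebra_simps)
  also have "c * (Y - X) = - (s * (2 * P))" using 4 by simp
  also have "c * - (s * (2 * P)) + s * (s * (Y - X)) = 0" unfolding 3 by simp
  finally have D: "Y = X" unfolding cs by simp
  then show ?thesis using 4 s by simp
qed

text \<open>For a non-real eigenvalue the real and imaginary parts of an eigenvector are orthogonal
  and of equal length, so one factor normalizes both. For eigenvalue 1 or -1 they may be
  proportional, and the second vector has to come from the parity argument instead. The signs are
  those of the columns of \<open>rot_block\<close>.\<close>

lemma SO_invariant_plane:
  assumes A: "A \<in> carrier (SO d)" and d: "even d" "0 < d"
    and ev: "eigenvalue (map_mat complex_of_real A) (cis \<theta>)"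
  obtains x y where "x \<in> carrier_vec d" "x \<bullet> x = 1" "y \<in> carrier_vec d" "y \<bullet> y = 1" "x \<bullet> y = 0"
    "A *\<^sub>v x = cos \<theta> \<cdot>\<^sub>v x - sin \<theta> \<cdot>\<^sub>v y" "A *\<^sub>v y = sin \<theta> \<cdot>\<^sub>v x + cos \<theta> \<cdot>\<^sub>v y"
proof (cases "sin \<theta> = 0")
  case True
  then have "cos \<theta> = 1 \<or> cos \<theta> = -1"
    using sin_cos_squared_add[of \<theta>] by (simp add: power2_eq_1_iff)
  have Ac: "A \<in> carrier_mat d d" using A by (simp add: SO_carrier_iff)
  have "cis \<theta> = of_real (cos \<theta>)" using True by (simp add: complex_eq_iff)
  with ev have "eigenvalue (map_mat complex_of_real A) (of_real (cos \<theta>))" by simp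
  then obtain x where x: "x \<in> carrier_vec d" "x \<bullet> x = 1" "A *\<^sub>v x = cos \<theta> \<cdot>\<^sub>v x"
    by (rule real_eigenvector_of_complex[OF Ac])
  obtain y where y: "y \<in> carrier_vec d" "y \<bullet> y = 1" "x \<bullet> y = 0" "A *\<^sub>v y = cos \<theta> \<cdot>\<^sub>v y"
    by (rule SO_second_real_eigenvector[OF A d \<open>cos \<theta> = 1 \<or> cos \<theta> = -1\<close> x])
  show thesis by (rule that[of x y]) (use x y True in auto)
next
  case False
  have Ao: "A \<in> orth d" using A by (auto simp: SO_iff_orth)
  note c = orthD[OF Ao]
  obtain v where v: "v \<in> carrier_vec d" "v \<noteq> 0\<^sub>v d" "map_mat complex_of_real A *\<^sub>v v = cis \<theta> \<cdot>\<^sub>v v"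
    using ev c(1) by (auto simp: eigenvalue_def eigenvector_def)
  define a b where "a = map_vec Re v" and "b = map_vec Im v"
  have ab: "a \<in> carrier_vec d" "b \<in> carrier_vec d" using v by (auto simp: a_def b_def)
  have Aa: "A *\<^sub>v a = cos \<theta> \<cdot>\<^sub>v a - sin \<theta> \<cdot>\<^sub>v b" and Ab: "A *\<^sub>v b = sin \<theta> \<cdot>\<^sub>v a + cos \<theta> \<cdot>\<^sub>v b"
    using complex_eigenvector_parts[OF c(1) v(1,3)] by (simp_all add: a_def b_def)
  have Aa': "A *\<^sub>v a = cos \<theta> \<cdot>\<^sub>v a + (- sin \<theta>) \<cdot>\<^sub>v b" unfolding Aa using ab by auto
  let ?c = "cos \<theta>" and ?s = "sin \<theta>"
  have cs: "?c * ?c + ?s * ?s = 1" using sin_cos_squared_add2[of \<theta>] by (simp add: power2_eq_square)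
  have 1: "a \<bullet> a = ?c * ?c * (a \<bullet> a) + (?c * - ?s + - ?s * ?c) * (a \<bullet> b) + - ?s * - ?s * (b \<bullet> b)"
    using orth_scalar_prod[OF Ao ab(1) ab(1)] scalar_prod_lincomb[OF ab] unfolding Aa' by simp
  have 2: "a \<bullet> b = ?c * ?s * (a \<bullet> a) + (?c * ?c + - ?s * ?s) * (a \<bullet> b) + - ?s * ?c * (b \<bullet> b)"
    using orth_scalar_prod[OF Ao ab] scalar_prod_lincomb[OF ab] unfolding Aa' Ab by simp
  have aa: "a \<bullet> a = b \<bullet> b" and o: "a \<bullet> b = 0"
    using rotation_isotropic[OF cs False 1 2] by simp_all
  have a0: "a \<noteq> 0\<^sub>v d"
  proof
    assume "a = 0\<^sub>v d"
    moreover from this have "b = 0\<^sub>v d" using aa scalar_prod_self_eq_0[OF ab(2)] by simp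
    ultimately have "map_vec Re v $ i = 0 \<and> map_vec Im v $ i = 0" if "i < d" for i
      using that by (simp flip: a_def b_def)
    then have "v = 0\<^sub>v d" using v(1) by (intro eq_vecI) (auto simp: complex_eq_iff)
    with v(2) show False by simp
  qed
  obtain r where r: "r \<noteq> 0" "(r \<cdot>\<^sub>v a) \<bullet> (r \<cdot>\<^sub>v a) = 1" by (rule normalize_vec[OF ab(1) a0])
  show thesis
  proof (rule that[of "r \<cdot>\<^sub>v a" "r \<cdot>\<^sub>v b"])
    show "(r \<cdot>\<^sub>v b) \<bullet> (r \<cdot>\<^sub>v b) = 1" using r(2) ab aa by simp
    show "(r \<cdot>\<^sub>v a) \<bullet> (r \<cdot>\<^sub>v b) = 0" using ab o by simp
    show "A *\<^sub>v (r \<cdot>\<^sub>v a) = ?c \<cdot>\<^sub>v (r \<cdot>\<^sub>v a) - ?s \<cdot>\<^sub>v (r \<cdot>\<^sub>v b)"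
      using ab by (simp add: mult_mat_vec[OF c(1)] Aa) (intro eq_vecI; simp add: algebra_simps)
    show "A *\<^sub>v (r \<cdot>\<^sub>v b) = ?s \<cdot>\<^sub>v (r \<cdot>\<^sub>v a) + ?c \<cdot>\<^sub>v (r \<cdot>\<^sub>v b)"
      using ab by (simp add: mult_mat_vec[OF c(1)] Ab) (intro eq_vecI; simp add: algebra_simps)
  qed (use r ab in auto)
qed

subsection \<open>Normal form up to orthogonal conjugation\<close>

lemma mult_carrier_square [intro]:
  "A \<in> carrier_mat d d \<Longrightarrow> B \<in> carrier_mat d d \<Longrightarrow> A * B \<in> carrier_mat d d"
  by (rule mult_carrier_mat)

lemma conj_conj_mat:
  fixes A :: "real mat"
  assumes P: "P \<in> carrier_mat d d" and Q: "Q \<in> carrier_mat d d" and A: "A \<in> carrier_mat d d"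
  shows "P * (Q * A * transpose_mat Q) * transpose_mat P = (P * Q) * A * transpose_mat (P * Q)"
proof -
  have T: "transpose_mat P \<in> carrier_mat d d" "transpose_mat Q \<in> carrier_mat d d"
    using P Q by auto
  have "P * (Q * A * transpose_mat Q) = P * Q * A * transpose_mat Q"
    using assoc_mult_mat[OF P mult_carrier_square[OF Q A] T(2)] assoc_mult_mat[OF P Q A] by simp
  then have "P * (Q * A * transpose_mat Q) * transpose_mat P = P * Q * A * transpose_mat Q * transpose_mat P"
    by simp
  also have "\<dots> = P * Q * A * (transpose_mat Q * transpose_mat P)"
    by (rule assoc_mult_mat[OF mult_carrier_square[OF mult_carrier_square[OF P Q] A] T(2,1)])
  finally show ?thesis by (simp add: transpose_mult[OF P Q])
qed

lemma conj_inverse: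
  assumes P: "P \<in> orth d" and A: "A \<in> carrier_mat d d" and B: "B = P * A * transpose_mat P"
  shows "A = transpose_mat P * B * P"
proof -
  note c = orthD[OF P]
  have "transpose_mat P * (P * A * transpose_mat P) * transpose_mat (transpose_mat P) =
      (transpose_mat P * P) * A * transpose_mat (transpose_mat P * P)"
    by (rule conj_conj_mat[OF c(2,1) A])
  then show ?thesis using A by (simp add: B c(4))
qed

lemma conj_one_mat: "A \<in> carrier_mat d d \<Longrightarrow> 1\<^sub>m d * A * transpose_mat (1\<^sub>m d) = (A :: real mat)"
  by simp

lemma char_poly_conj:
  assumes P: "P \<in> orth d" and A: "A \<in> carrier_mat d d"
  shows "char_poly (P * A * transpose_mat P) = char_poly A"
proof (rule char_poly_similar, rule similar_matI)
  note c = orthD[OF P]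
  show "{P * A * transpose_mat P, A, P, transpose_mat P} \<subseteq> carrier_mat d d" using c A by auto
qed (use orthD[OF P] in auto)

lemma conj_SO:
  assumes P: "P \<in> orth d" and A: "A \<in> carrier (SO d)"
  shows "P * A * transpose_mat P \<in> carrier (SO d)"
proof -
  note c = orthD[OF P]
  have Ao: "A \<in> orth d" "Determinant.det A = 1" "A \<in> carrier_mat d d"
    using A by (auto simp: SO_iff_orth orth_def)
  have "Determinant.det (P * A * transpose_mat P) = Determinant.det P * Determinant.det P"
    using Ao c Determinant.det_mult[of "P * A" d "transpose_mat P"] Determinant.det_mult[of P d A]
      Determinant.det_transpose[OF c(1)] by (simp add: mult_carrier_square)
  then show ?thesis
    using det_orth[OF P] orth_mult[OF orth_mult[OF P Ao(1)] orth_transpose[OF P]]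
    by (auto simp: SO_iff_orth)
qed

text \<open>The squared Hermitian length of the eigenvector is
  \<open>a \<bullet> a + b \<bullet> b\<close> in its real and imaginary parts; \<open>A\<close>
  preserves it and also multiplies it by the squared modulus of \<open>z\<close>.\<close>

lemma orth_eigenvalue_norm:
  assumes A: "A \<in> orth d" and ev: "eigenvalue (map_mat complex_of_real A) z"
  shows "norm z = 1"
proof -
  note c = orthD[OF A]
  obtain v where v: "v \<in> carrier_vec d" "v \<noteq> 0\<^sub>v d" "map_mat complex_of_real A *\<^sub>v v = z \<cdot>\<^sub>v v"
    using ev c(1) by (auto simp: eigenvalue_def eigenvector_def)
  define a b where "a = map_vec Re v" and "b = map_vec Im v"
  have ab: "a \<in> carrier_vec d" "b \<in> carrier_vec d" using v by (auto simp: a_def b_def)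
  have Aa: "A *\<^sub>v a = Re z \<cdot>\<^sub>v a + (- Im z) \<cdot>\<^sub>v b"
    using complex_eigenvector_parts(1)[OF c(1) v(1,3)] ab by (auto simp flip: a_def b_def)
  have Ab: "A *\<^sub>v b = Im z \<cdot>\<^sub>v a + Re z \<cdot>\<^sub>v b"
    using complex_eigenvector_parts(2)[OF c(1) v(1,3)] by (simp flip: a_def b_def)
  have "a \<bullet> a + b \<bullet> b = (A *\<^sub>v a) \<bullet> (A *\<^sub>v a) + (A *\<^sub>v b) \<bullet> (A *\<^sub>v b)"
    using orth_scalar_prod[OF A ab(1) ab(1)] orth_scalar_prod[OF A ab(2) ab(2)] by simp
  also have "\<dots> = (Re z * Re z + Im z * Im z) * (a \<bullet> a + b \<bullet> b)"
    unfolding Aa Ab scalar_prod_lincomb[OF ab] by (simp add: algebra_simps)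
  finally have e: "(a \<bullet> a + b \<bullet> b) = (Re z * Re z + Im z * Im z) * (a \<bullet> a + b \<bullet> b)" .
  have nn: "a \<bullet> a \<ge> 0" "b \<bullet> b \<ge> 0" by (simp_all add: scalar_prod_def sum_nonneg)
  have "a \<bullet> a + b \<bullet> b \<noteq> 0"
  proof
    assume "a \<bullet> a + b \<bullet> b = 0"
    then have "a \<bullet> a = 0" "b \<bullet> b = 0" using nn by linarith+
    then have "a = 0\<^sub>v d" "b = 0\<^sub>v d" using scalar_prod_self_eq_0 ab by auto
    then have "map_vec Re v $ i = 0 \<and> map_vec Im v $ i = 0" if "i < d" for i
      using that by (simp flip: a_def b_def)
    then have "v = 0\<^sub>v d" using v(1) by (intro eq_vecI) (auto simp: complex_eq_iff)
    with v(2) show False by simp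
  qed
  with e have "Re z * Re z + Im z * Im z = 1" by simp
  then show ?thesis by (simp add: cmod_def power2_eq_square)
qed

lemma SO_split_rotation:
  assumes A: "A \<in> carrier (SO (2 + d))" and d: "even d"
    and ev: "eigenvalue (map_mat complex_of_real A) (cis (2 * pi * t))"
  obtains W A' where "W \<in> orth (2 + d)" "A' \<in> carrier (SO d)"
    "A = W * dsum (rot_block t) A' * transpose_mat W"
proof -
  let ?n = "2 + d" and ?c = "cos (2 * pi * t)" and ?s = "sin (2 * pi * t)"
  let ?e = "unit_vec ?n 0 :: real vec" and ?f = "unit_vec ?n 1 :: real vec"
  have n: "even ?n" "0 < ?n" "2 \<le> ?n" using d by auto
  obtain x y where x: "x \<in> carrier_vec ?n" "x \<bullet> x = 1" and y: "y \<in> carrier_vec ?n" "y \<bullet> y = 1"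
    and xy: "x \<bullet> y = 0" and Ax: "A *\<^sub>v x = ?c \<cdot>\<^sub>v x - ?s \<cdot>\<^sub>v y" and Ay: "A *\<^sub>v y = ?s \<cdot>\<^sub>v x + ?c \<cdot>\<^sub>v y"
    by (rule SO_invariant_plane[OF A n(1,2) ev])
  obtain W where W: "W \<in> orth ?n" "W *\<^sub>v ?e = x" "W *\<^sub>v ?f = y"
    by (rule orth_completion[OF x y xy n(3)])
  note c = orthD[OF W(1)]
  have Ac: "A \<in> carrier_mat ?n ?n" using A by (simp add: SO_carrier_iff)
  define B where "B = transpose_mat W * A * W"
  have BSO: "B \<in> carrier (SO ?n)"
    using conj_SO[OF orth_transpose[OF W(1)] A] by (simp add: B_def)
  then have Bo: "B \<in> orth ?n" and detB: "Determinant.det B = 1" by (auto simp: SO_iff_orth)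
  note Bc = orthD[OF Bo]
  have ef: "?e \<in> carrier_vec ?n" "?f \<in> carrier_vec ?n" by auto
  have Wx: "transpose_mat W *\<^sub>v x = ?e" "transpose_mat W *\<^sub>v y = ?f"
    using orth_cancel_vec(1)[OF W(1) ef(1)] orth_cancel_vec(1)[OF W(1) ef(2)] W by auto
  have Bv: "B *\<^sub>v v = transpose_mat W *\<^sub>v (A *\<^sub>v (W *\<^sub>v v))" if v: "v \<in> carrier_vec ?n" for v
    unfolding B_def
    using assoc_mult_mat_vec[OF mult_carrier_square[OF c(2) Ac] c(1) v]
      assoc_mult_mat_vec[OF c(2) Ac mult_mat_vec_carrier[OF c(1) v]] by simp
  have Be: "B *\<^sub>v ?e = ?c \<cdot>\<^sub>v ?e - ?s \<cdot>\<^sub>v ?f"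
    unfolding Bv[OF ef(1)] W(2) Ax using x y Wx
    by (simp add: mult_minus_distrib_mat_vec[OF c(2)] mult_mat_vec[OF c(2)])
  have Bf: "B *\<^sub>v ?f = ?s \<cdot>\<^sub>v ?e + ?c \<cdot>\<^sub>v ?f"
    unfolding Bv[OF ef(2)] W(3) Ay using x y Wx
    by (simp add: mult_add_distrib_mat_vec[OF c(2)] mult_mat_vec[OF c(2)])
  have cs: "?c * ?c + ?s * ?s = 1" using sin_cos_squared_add2[of "2 * pi * t"] by (simp add: power2_eq_square)
  \<comment> \<open>Rows 0 and 1 of \<open>B\<close> are needed as well, to see that the block to
    the right of the rotation is zero. They are columns of \<open>transpose_mat B\<close>, the
    inverse of \<open>B\<close>, and are found by exhibiting the preimages of \<open>?e\<close> and
    \<open>?f\<close> under \<open>B\<close>.\<close>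
  have "B *\<^sub>v (?c \<cdot>\<^sub>v ?e + ?s \<cdot>\<^sub>v ?f) = ?c \<cdot>\<^sub>v (?c \<cdot>\<^sub>v ?e - ?s \<cdot>\<^sub>v ?f) + ?s \<cdot>\<^sub>v (?s \<cdot>\<^sub>v ?e + ?c \<cdot>\<^sub>v ?f)"
    unfolding Be[symmetric] Bf[symmetric]
    using ef by (simp add: mult_add_distrib_mat_vec[OF Bc(1)] mult_mat_vec[OF Bc(1)])
  also have "\<dots> = ?e"
    by (intro eq_vecI) (auto simp: algebra_simps cs)
  finally have BTe: "transpose_mat B *\<^sub>v ?e = ?c \<cdot>\<^sub>v ?e + ?s \<cdot>\<^sub>v ?f"
    using orth_cancel_vec(1)[OF Bo, of "?c \<cdot>\<^sub>v ?e + ?s \<cdot>\<^sub>v ?f"] by simp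
  have "B *\<^sub>v (?c \<cdot>\<^sub>v ?f - ?s \<cdot>\<^sub>v ?e) = ?c \<cdot>\<^sub>v (?s \<cdot>\<^sub>v ?e + ?c \<cdot>\<^sub>v ?f) - ?s \<cdot>\<^sub>v (?c \<cdot>\<^sub>v ?e - ?s \<cdot>\<^sub>v ?f)"
    unfolding Be[symmetric] Bf[symmetric]
    using ef by (simp add: mult_minus_distrib_mat_vec[OF Bc(1)] mult_mat_vec[OF Bc(1)])
  also have "\<dots> = ?f"
    by (intro eq_vecI) (auto simp: algebra_simps cs)
  finally have BTf: "transpose_mat B *\<^sub>v ?f = ?c \<cdot>\<^sub>v ?f - ?s \<cdot>\<^sub>v ?e"
    using orth_cancel_vec(1)[OF Bo, of "?c \<cdot>\<^sub>v ?f - ?s \<cdot>\<^sub>v ?e"] by simp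
  define A' where "A' = mat d d (\<lambda>(i, j). B $$ (i + 2, j + 2))"
  have A'c: "A' \<in> carrier_mat d d" by (simp add: A'_def)
  have dimB: "dim_row B = ?n" "dim_col B = ?n" using Bc(1) by auto
  have col0: "B $$ (i, 0) = (?c \<cdot>\<^sub>v ?e - ?s \<cdot>\<^sub>v ?f) $ i" and col1: "B $$ (i, Suc 0) = (?s \<cdot>\<^sub>v ?e + ?c \<cdot>\<^sub>v ?f) $ i"
    and row0: "B $$ (0, i) = (?c \<cdot>\<^sub>v ?e + ?s \<cdot>\<^sub>v ?f) $ i" and row1: "B $$ (Suc 0, i) = (?c \<cdot>\<^sub>v ?f - ?s \<cdot>\<^sub>v ?e) $ i"
    if "i < ?n" for i
    unfolding Be[symmetric] Bf[symmetric] BTe[symmetric] BTf[symmetric]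
    using that dimB mult_unit_vec[OF Bc(1), of 0] mult_unit_vec[OF Bc(1), of 1]
      mult_unit_vec[OF Bc(2), of 0] mult_unit_vec[OF Bc(2), of 1]
    by simp_all
  have "B = dsum (rot_block t) A'"
  proof (rule eq_matI)
    fix i j assume "i < dim_row (dsum (rot_block t) A')" "j < dim_col (dsum (rot_block t) A')"
    then have ij: "i < ?n" "j < ?n" by (auto simp: dsum_def A'_def)
    consider "j = 0" | "j = Suc 0" | "i = 0" | "i = Suc 0" | i' j' where "i = i' + 2" "j = j' + 2"
      by (metis One_nat_def Suc_1 add.commute less_2_cases_iff le_add_diff_inverse not_less)
    then show "B $$ (i, j) = dsum (rot_block t) A' $$ (i, j)"
    proof cases
      case 1
      then show ?thesis using col0[OF ij(1)] ij
        by (cases "i = 0 \<or> i = Suc 0") (auto simp: dsum_def A'_def)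
    next
      case 2
      then show ?thesis using col1[OF ij(1)] ij
        by (cases "i = 0 \<or> i = Suc 0") (auto simp: dsum_def A'_def)
    next
      case 3
      then show ?thesis using row0[OF ij(2)] ij
        by (cases "j = 0 \<or> j = Suc 0") (auto simp: dsum_def A'_def)
    next
      case 4
      then show ?thesis using row1[OF ij(2)] ij
        by (cases "j = 0 \<or> j = Suc 0") (auto simp: dsum_def A'_def)
    next
      case 5
      then show ?thesis using ij by (simp add: dsum_def A'_def)
    qed
  qed (auto simp: dsum_def A'_def dimB)
  then have "A' \<in> orth d" "Determinant.det A' = 1"
    using Bo detB dsum_orth_iff[OF rot_block_carrier A'c, of t] det_dsum[OF rot_block_carrier A'c, of t]
    by (simp_all add: det_rot_block)
  then have "A' \<in> carrier (SO d)" by (simp add: SO_iff_orth)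
  moreover have "A = W * B * transpose_mat W"
    using conj_inverse[OF orth_transpose[OF W(1)] Ac, of B] by (simp add: B_def)
  ultimately show thesis
    using that W(1) \<open>B = dsum (rot_block t) A'\<close> by simp
qed

text \<open>The angles are split off in the order given by \<open>ts\<close>: the factor
  \<open>angle_poly t\<close> provides the eigenvalue, and cancelling it leaves the characteristic
  polynomial of the complementary block. As every ordering of the angles is covered, the sorted one
  can serve as representative later.\<close>

lemma conj_block_rotation:
  assumes "A \<in> carrier (SO (2 * length ts))" "char_poly A = (\<Prod>t\<leftarrow>ts. angle_poly t)"
  shows "\<exists>P\<in>orth (2 * length ts). A = P * block_rotation ts * transpose_mat P"
  using assms
proof (induction ts arbitrary: A)
  case Nil
  then have "A \<in> carrier_mat 0 0" by (simp add: SO_carrier_iff)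
  then have "A = 1\<^sub>m 0" by auto
  then show ?case by (intro bexI[of _ "1\<^sub>m 0"]) (auto simp: block_rotation_Nil)
next
  case (Cons t ts)
  interpret h: map_poly_comm_ring_hom complex_of_real ..
  let ?d = "2 * length ts"
  have A: "A \<in> carrier (SO (2 + ?d))" using Cons.prems(1) by simp
  then have Ac: "A \<in> carrier_mat (2 + ?d) (2 + ?d)" by (simp add: SO_carrier_iff)
  have "char_poly (map_mat complex_of_real A) = map_poly complex_of_real (char_poly A)"
    by (rule of_real_hom.char_poly_hom[OF Ac])
  also have "\<dots> = map_poly complex_of_real (angle_poly t) * map_poly complex_of_real (\<Prod>t\<leftarrow>ts. angle_poly t)"
    unfolding Cons.prems(2) by (simp add: h.hom_mult)
  finally have "poly (char_poly (map_mat complex_of_real A)) (cis (2 * pi * t)) = 0"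
    by (simp add: poly_angle_poly_complex)
  then have "eigenvalue (map_mat complex_of_real A) (cis (2 * pi * t))"
    using eigenvalue_root_char_poly[of "map_mat complex_of_real A" "2 + ?d"] Ac by simp
  then obtain W A' where W: "W \<in> orth (2 + ?d)" and A': "A' \<in> carrier (SO ?d)"
    and e: "A = W * dsum (rot_block t) A' * transpose_mat W"
    using SO_split_rotation[OF A] by auto
  have A'c: "A' \<in> carrier_mat ?d ?d" using A' by (simp add: SO_carrier_iff)
  have "angle_poly t * char_poly A' = angle_poly t * (\<Prod>t\<leftarrow>ts. angle_poly t)"
    using char_poly_conj[OF W dsum_carrier[OF rot_block_carrier A'c], of t] Cons.prems(2)
      char_poly_dsum[OF rot_block_carrier A'c, of t]
    by (auto simp: char_poly_rot_block simp flip: e)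
  moreover have "angle_poly t \<noteq> 0" by (simp add: angle_poly_def)
  ultimately have "char_poly A' = (\<Prod>t\<leftarrow>ts. angle_poly t)" by simp
  then obtain Q where Q: "Q \<in> orth ?d" and A'Q: "A' = Q * block_rotation ts * transpose_mat Q"
    using Cons.IH[OF A'] by blast
  note Qc = orthD[OF Q] and R = block_rotation_carrier[of ts]
  let ?Q = "dsum (1\<^sub>m 2) Q"
  have Qo: "?Q \<in> orth (2 + ?d)" using dsum_orth_iff[OF one_carrier_mat Qc(1)] Q one_orth by blast
  have "dsum (rot_block t) A' = ?Q * block_rotation (t # ts) * transpose_mat ?Q"
    unfolding A'Q block_rotation_Cons dsum_transpose[OF one_carrier_mat Qc(1)]
    using dsum_mult[OF one_carrier_mat Qc(1) rot_block_carrier R, of t]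
      dsum_mult[OF _ mult_carrier_square[OF Qc(1) R] one_carrier_mat Qc(2), of "rot_block t"]
      left_mult_one_mat[OF rot_block_carrier] right_mult_one_mat[OF rot_block_carrier]
    by simp
  then have "A = (W * ?Q) * block_rotation (t # ts) * transpose_mat (W * ?Q)"
    using e conj_conj_mat[OF orthD(1)[OF W] orthD(1)[OF Qo], of "block_rotation (t # ts)"]
      block_rotation_carrier[of "t # ts"] by simp
  then show ?case using orth_mult[OF W Qo] by auto
qed

text \<open>A complex eigenvalue exists, lies on the unit circle, and splits off a plane. Only the
  characteristic polynomial is recorded, because it does not change when \<open>t\<close> is
  replaced by its folded angle; the matrix is recovered from it by
  \<open>conj_block_rotation\<close>.\<close>

lemma SO_char_poly:
  assumes "A \<in> carrier (SO (2 * n))"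
  shows "\<exists>ts. length ts = n \<and> set ts \<subseteq> {0..1/2} \<and> char_poly A = (\<Prod>t\<leftarrow>ts. angle_poly t)"
  using assms
proof (induction n arbitrary: A)
  case 0
  then have "A = block_rotation []" by (auto simp: block_rotation_Nil SO_carrier_iff)
  then show ?case using char_poly_block_rotation[of "[]"] by simp
next
  case (Suc n)
  have A: "A \<in> carrier (SO (2 + 2 * n))" using Suc.prems by simp
  then have Ac: "A \<in> carrier_mat (2 + 2 * n) (2 + 2 * n)" by (simp add: SO_carrier_iff)
  have "spectrum (map_mat complex_of_real A) \<noteq> {}"
    by (rule spectrum_non_empty[of _ "2 + 2 * n"]) (use Ac in auto)
  then obtain z where z: "eigenvalue (map_mat complex_of_real A) z" by (auto simp: spectrum_def)
  then have "norm z = 1" using A orth_eigenvalue_norm SO_iff_orth by blast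
  then have "z = cis (Arg z)" using cis_Arg[of z] by (cases "z = 0") (auto simp: sgn_eq)
  define t where "t = Arg z / (2 * pi)"
  have "z = cis (2 * pi * t)" using \<open>z = cis (Arg z)\<close> by (simp add: t_def)
  with z obtain W A' where W: "W \<in> orth (2 + 2 * n)" and A': "A' \<in> carrier (SO (2 * n))"
    and e: "A = W * dsum (rot_block t) A' * transpose_mat W"
    using SO_split_rotation[OF A] by auto
  have A'c: "A' \<in> carrier_mat (2 * n) (2 * n)" using A' by (simp add: SO_carrier_iff)
  obtain ts where ts: "length ts = n" "set ts \<subseteq> {0..1/2}" "char_poly A' = (\<Prod>t\<leftarrow>ts. angle_poly t)"
    using Suc.IH[OF A'] by blast
  have "char_poly A = angle_poly t * char_poly A'"
    using char_poly_conj[OF W dsum_carrier[OF rot_block_carrier A'c], of t]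
      char_poly_dsum[OF rot_block_carrier A'c, of t]
    by (simp add: char_poly_rot_block flip: e)
  also have "angle_poly t = angle_poly (folded_angle t)"
    by (simp add: angle_poly_def cos_folded_angle)
  finally show ?case
    using ts folded_angle_props(1,2)[of t] by (intro exI[of _ "folded_angle t # ts"]) auto
qed

subsection \<open>Centralizers\<close>

text \<open>Commutation makes the cross terms of (A + iB)(A - iB) cancel. The second factor is the
  entrywise conjugate of the first, so the determinant is a squared modulus.\<close>

lemma det_sum_squares_commuting:
  fixes A B :: "real mat"
  assumes A: "A \<in> carrier_mat d d" and B: "B \<in> carrier_mat d d" and AB: "A * B = B * A"
  shows "0 \<le> Determinant.det (A * A + B * B)"
proof -
  interpret cnj: comm_ring_hom cnj by unfold_locales auto
  let ?c = "map_mat complex_of_real"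
  define X where "X = ?c A + \<i> \<cdot>\<^sub>m ?c B"
  define Y where "Y = ?c A + (- \<i>) \<cdot>\<^sub>m ?c B"
  have c: "?c A \<in> carrier_mat d d" "?c B \<in> carrier_mat d d" using A B by auto
  have XY: "X \<in> carrier_mat d d" "Y \<in> carrier_mat d d" using c by (auto simp: X_def Y_def)
  have "?c (A * A + B * B) = X * Y"
  proof (rule eq_matI)
    fix i j assume "i < dim_row (X * Y)" "j < dim_col (X * Y)"
    then have i: "i < d" and j: "j < d" using XY by auto
    have "(\<Sum>k = 0..<d. A $$ (i, k) * B $$ (k, j)) = (A * B) $$ (i, j)"
      using A B i j by (simp add: scalar_prod_def)
    also have "\<dots> = (\<Sum>k = 0..<d. B $$ (i, k) * A $$ (k, j))"
      unfolding AB using A B i j by (simp add: scalar_prod_def)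
    finally have com: "(\<Sum>k = 0..<d. A $$ (i, k) * B $$ (k, j)) = (\<Sum>k = 0..<d. B $$ (i, k) * A $$ (k, j))" .
    have "(X * Y) $$ (i, j) = (\<Sum>k = 0..<d. (A $$ (i, k) + \<i> * B $$ (i, k)) * (A $$ (k, j) - \<i> * B $$ (k, j)))"
      using i j A B XY by (simp add: scalar_prod_def X_def Y_def)
    also have "\<dots> = of_real (\<Sum>k = 0..<d. A $$ (i, k) * A $$ (k, j)) + of_real (\<Sum>k = 0..<d. B $$ (i, k) * B $$ (k, j))
      + \<i> * (of_real (\<Sum>k = 0..<d. B $$ (i, k) * A $$ (k, j)) - of_real (\<Sum>k = 0..<d. A $$ (i, k) * B $$ (k, j)))"
      by (simp add: algebra_simps sum.distrib sum_subtractf sum_distrib_left)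
    finally show "?c (A * A + B * B) $$ (i, j) = (X * Y) $$ (i, j)"
      unfolding com using i j A B by (simp add: scalar_prod_def)
  qed (use A B XY in auto)
  moreover have "Y = map_mat cnj X" using A B by (auto simp: X_def Y_def)
  ultimately have "complex_of_real (Determinant.det (A * A + B * B)) = Determinant.det X * cnj (Determinant.det X)"
    using Determinant.det_mult[OF XY] by (simp flip: of_real_hom.hom_det cnj.hom_det)
  also have "\<dots> = of_real ((norm (Determinant.det X))\<^sup>2)" by (rule complex_norm_square[symmetric])
  finally show ?thesis unfolding of_real_eq_iff by simp
qed

text \<open>With \<open>J\<^sup>2 = -1\<close> one has \<open>4g = (g + 1)\<^sup>2 + ((g - 1) J)\<^sup>2\<close>.\<close>

lemma det_commutes_complex_structure:
  fixes g J :: "real mat"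
  assumes g: "g \<in> carrier_mat d d" and J: "J \<in> carrier_mat d d"
    and JJ: "J * J = (-1) \<cdot>\<^sub>m 1\<^sub>m d" and gJ: "g * J = J * g"
  shows "0 \<le> Determinant.det g"
proof -
  let ?A = "g + 1\<^sub>m d" and ?N = "g - 1\<^sub>m d"
  let ?B = "?N * J"
  have c: "?A \<in> carrier_mat d d" "?N \<in> carrier_mat d d" "?B \<in> carrier_mat d d" "g * g \<in> carrier_mat d d"
    using g J by (auto intro: minus_carrier_mat)
  have NJ: "?N * J = J * ?N" and AJ: "?A * J = J * ?A"
    using g J by (simp_all add: minus_mult_distrib_mat[OF g one_carrier_mat J] gJ
        mult_minus_distrib_mat[OF J g one_carrier_mat]
        add_mult_distrib_mat[OF g one_carrier_mat J] mult_add_distrib_mat[OF J g one_carrier_mat])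
  have gN: "g * ?N = g * g - g" and gA: "g * ?A = g * g + g"
    using mult_minus_distrib_mat[OF g g one_carrier_mat] mult_add_distrib_mat[OF g g one_carrier_mat] g by simp_all
  have AA: "?A * ?A = g * g + g + (g + 1\<^sub>m d)" and NN: "?N * ?N = g * g - g - (g - 1\<^sub>m d)"
    using add_mult_distrib_mat[OF g one_carrier_mat c(1)] minus_mult_distrib_mat[OF g one_carrier_mat c(2)] c(1,2)
    by (simp_all add: gN gA)
  have "?A * ?N = g * g - g + (g - 1\<^sub>m d)" "?N * ?A = g * g + g - (g + 1\<^sub>m d)"
    using add_mult_distrib_mat[OF g one_carrier_mat c(2)] minus_mult_distrib_mat[OF g one_carrier_mat c(1)] c(1,2)
    by (simp_all add: gN gA)
  then have AN: "?A * ?N = g * g - 1\<^sub>m d" and NA: "?N * ?A = g * g - 1\<^sub>m d"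
    using g by (auto intro!: eq_matI)
  have "?A * ?B = ?A * ?N * J" by (rule assoc_mult_mat[OF c(1,2) J, symmetric])
  also have "\<dots> = ?N * (?A * J)" unfolding AN NA[symmetric] by (rule assoc_mult_mat[OF c(2,1) J])
  also have "\<dots> = ?B * ?A" unfolding AJ by (rule assoc_mult_mat[OF c(2) J c(1), symmetric])
  finally have AB: "?A * ?B = ?B * ?A" .
  have "?B * ?B = ?N * (J * (?N * J))" by (rule assoc_mult_mat[OF c(2) J c(3)])
  also have "J * (?N * J) = ?N * (J * J)"
    unfolding assoc_mult_mat[OF J c(2) J, symmetric] NJ[symmetric] by (rule assoc_mult_mat[OF c(2) J J])
  also have "\<dots> = (-1) \<cdot>\<^sub>m ?N" unfolding JJ using mult_smult_distrib[OF c(2) one_carrier_mat] c(2) by simp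
  also have "?N * \<dots> = (-1) \<cdot>\<^sub>m (?N * ?N)" by (rule mult_smult_distrib[OF c(2,2)])
  finally have BB: "?B * ?B = (-1) \<cdot>\<^sub>m (?N * ?N)" .
  have "?A * ?A + ?B * ?B = 4 \<cdot>\<^sub>m g"
    unfolding BB AA NN using g by (intro eq_matI) auto
  then have "0 \<le> 4 ^ d * Determinant.det g"
    using det_sum_squares_commuting[OF c(1,3) AB] g by simp
  then show ?thesis using mult_left_le_imp_le[of "4 ^ d" 0 "Determinant.det g"] by simp
qed

text \<open>The square of D J is -D^2, so \<open>g\<close> commutes with D^2: entrywise,
  \<open>g $$ (i, j)\<close> vanishes unless \<open>s i\<close> and \<open>s j\<close> have equal
  squares. Being positive, they are then equal, so \<open>g\<close> commutes with D, and D can be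
  cancelled from the relation with D J.\<close>

lemma commutes_scaled_complex_structure:
  fixes g J :: "real mat"
  assumes g: "g \<in> carrier_mat d d" and J: "J \<in> carrier_mat d d"
    and JJ: "J * J = (-1) \<cdot>\<^sub>m 1\<^sub>m d"
    and s: "\<And>i. i < d \<Longrightarrow> 0 < s i"
    and DJ: "mat_diag d s * J = J * mat_diag d s"
    and gK: "g * (mat_diag d s * J) = (mat_diag d s * J) * g"
  shows "g * J = J * g"
proof -
  let ?D = "mat_diag d s"
  have D: "?D \<in> carrier_mat d d" by simp
  have K: "?D * J \<in> carrier_mat d d" using D J by auto
  have "(?D * J) * (?D * J) = ?D * (J * (J * ?D))"
    unfolding DJ[symmetric] by (rule assoc_mult_mat[OF D J K])
  also have "J * (J * ?D) = (-1) \<cdot>\<^sub>m ?D"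
    unfolding assoc_mult_mat[OF J J D, symmetric] JJ
    using mult_smult_assoc_mat[OF one_carrier_mat D] left_mult_one_mat[OF D] by simp
  also have "?D * \<dots> = (-1) \<cdot>\<^sub>m mat_diag d (\<lambda>i. s i * s i)"
    using mult_smult_distrib[OF D D] by simp
  finally have KK: "(?D * J) * (?D * J) = (-1) \<cdot>\<^sub>m mat_diag d (\<lambda>i. s i * s i)" .
  let ?E = "mat_diag d (\<lambda>i. s i * s i)"
  have E: "?E \<in> carrier_mat d d" by simp
  have "g * ((?D * J) * (?D * J)) = ((?D * J) * (?D * J)) * g"
    unfolding assoc_mult_mat[OF g K K, symmetric] gK assoc_mult_mat[OF K g K] assoc_mult_mat[OF K K g] ..
  then have "(-1) \<cdot>\<^sub>m (g * ?E) = (-1) \<cdot>\<^sub>m (?E * g)"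
    unfolding KK mult_smult_distrib[OF g E] mult_smult_assoc_mat[OF E g] .
  then have e: "((-1) \<cdot>\<^sub>m (g * ?E)) $$ (i, j) = ((-1) \<cdot>\<^sub>m (?E * g)) $$ (i, j)" for i j by simp
  have gs: "g $$ (i, j) * s j = s i * g $$ (i, j)" if "i < d" "j < d" for i j
  proof -
    have "g $$ (i, j) * (s j * s j) = s i * s i * g $$ (i, j)"
      using e[of i j] that g by (simp add: mat_diag_mult_left[OF g] mat_diag_mult_right[OF g])
    then have "g $$ (i, j) = 0 \<or> s i * s i = s j * s j" by auto
    then show ?thesis using s that by (metis less_imp_le mult.commute mult_zero_left power2_eq_iff_nonneg power2_eq_square)
  qed
  have gD: "g * ?D = ?D * g"
    unfolding mat_diag_mult_left[OF g] mat_diag_mult_right[OF g] by (auto simp: gs)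
  have "(g * J) * ?D = g * (?D * J)"
    unfolding DJ by (rule assoc_mult_mat[OF g J D])
  also have "\<dots> = J * (?D * g)"
    unfolding gK unfolding DJ by (rule assoc_mult_mat[OF J D g])
  also have "\<dots> = (J * g) * ?D"
    unfolding gD[symmetric] by (rule assoc_mult_mat[OF J g D, symmetric])
  finally have f: "((g * J) * ?D) $$ (i, j) = ((J * g) * ?D) $$ (i, j)" for i j by simp
  have gJ: "g * J \<in> carrier_mat d d" "J * g \<in> carrier_mat d d" using g J by auto
  show ?thesis
  proof (rule eq_matI)
    fix i j assume "i < dim_row (J * g)" "j < dim_col (J * g)"
    then have ij: "i < d" "j < d" using gJ by auto
    have "(g * J) $$ (i, j) * s j = (J * g) $$ (i, j) * s j"
      using f[of i j] ij unfolding mat_diag_mult_right[OF gJ(1)] mat_diag_mult_right[OF gJ(2)] by simp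
    then show "(g * J) $$ (i, j) = (J * g) $$ (i, j)" using s[OF ij(2)] by simp
  qed (use g J in auto)
qed

lemma rot_block_index_mod:
  assumes "i < 2" "j < 2"
  shows "rot_block t $$ (i, j) = (if i = j then cos (2 * pi * t) else if i < j then sin (2 * pi * t) else - sin (2 * pi * t))"
  using assms by (auto simp: numeral_2_eq_2 less_Suc_eq)

text \<open>Coordinate \<open>i\<close> belongs to the plane \<open>i div 2\<close>, at position
  \<open>i mod 2\<close>. This closed form allows different block rotations to be compared entry by
  entry.\<close>

lemma block_rotation_index:
  assumes "i < 2 * length ts" "j < 2 * length ts"
  shows "block_rotation ts $$ (i, j) =
    (if i div 2 = j div 2 then rot_block (ts ! (i div 2)) $$ (i mod 2, j mod 2) else 0)"
  using assms
proof (induction ts arbitrary: i j)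
  case (Cons t ts)
  have dims: "dim_row (block_rotation ts) = 2 * length ts" "dim_col (block_rotation ts) = 2 * length ts"
    using block_rotation_carrier[of ts] by auto
  have "i < 2 \<or> (\<exists>i'. i = i' + 2)" "j < 2 \<or> (\<exists>j'. j = j' + 2)"
    by (metis add.commute le_add_diff_inverse not_less)+
  then consider "i < 2" "j < 2" | i' where "i = i' + 2" "j < 2" | j' where "i < 2" "j = j' + 2"
    | i' j' where "i = i' + 2" "j = j' + 2" by blast
  then show ?case
    by cases (use Cons in \<open>auto simp: block_rotation_Cons dsum_def dims\<close>)
qed simp

lemma det_centralizer_block_rotation:
  assumes g: "g \<in> orth (2 * length ts)" and com: "g * block_rotation ts = block_rotation ts * g"
    and ts: "\<And>t. t \<in> set ts \<Longrightarrow> 0 < t \<and> t < 1/2"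
  shows "Determinant.det g = 1"
proof -
  let ?d = "2 * length ts" and ?R = "block_rotation ts"
  let ?T = "transpose_mat ?R"
  \<comment> \<open>Angle 1/4 is a quarter turn. Both the diagonal of \<open>rot_block\<close> and
    its transpose carry the cosine, so \<open>?R - ?T\<close> keeps only twice the sines, which are
    the entries of \<open>s\<close>; they are constant on each plane, hence commute with
    \<open>J\<close>.\<close>
  define J where "J = block_rotation (replicate (length ts) (1/4))"
  define s where "s = (\<lambda>i. 2 * sin (2 * pi * ts ! (i div 2)))"
  note gc = orthD[OF g]
  have Ro: "?R \<in> orth ?d" using block_rotation_SO[of ts] by (simp add: SO_iff_orth)
  note R = orthD[OF Ro]
  have J: "J \<in> carrier_mat ?d ?d"
    using block_rotation_carrier[of "replicate (length ts) (1/4)"] by (simp add: J_def)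
  have Jij: "J $$ (i, j) = (if i div 2 = j div 2 then (if i mod 2 = j mod 2 then 0 else if i mod 2 < j mod 2 then 1 else -1) else 0)"
    if "i < ?d" "j < ?d" for i j
    unfolding J_def using that by (subst block_rotation_index) (auto simp: rot_block_index_mod)
  have JJ: "J * J = (-1) \<cdot>\<^sub>m 1\<^sub>m ?d"
  proof -
    have "J * transpose_mat J = 1\<^sub>m ?d"
      using block_rotation_SO[of "replicate (length ts) (1/4)"] by (simp add: SO_carrier_iff J_def)
    moreover have "transpose_mat J = (-1) \<cdot>\<^sub>m J"
      using J by (intro eq_matI) (auto simp: Jij)
    ultimately have "(-1) \<cdot>\<^sub>m (J * J) = 1\<^sub>m ?d" using mult_smult_distrib[OF J J] by simp
    then have "(-1) \<cdot>\<^sub>m ((-1) \<cdot>\<^sub>m (J * J)) = (-1) \<cdot>\<^sub>m 1\<^sub>m ?d" by simp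
    moreover have "(-1) \<cdot>\<^sub>m ((-1) \<cdot>\<^sub>m (J * J)) = J * J" using J by (intro eq_matI) auto
    ultimately show ?thesis by simp
  qed
  have DJ: "mat_diag ?d s * J = J * mat_diag ?d s"
    unfolding mat_diag_mult_left[OF J] mat_diag_mult_right[OF J] by (auto simp: Jij s_def)
  have K: "mat_diag ?d s * J = ?R - ?T"
    unfolding mat_diag_mult_left[OF J]
  proof (rule eq_matI)
    fix i j assume "i < dim_row (?R - ?T)" "j < dim_col (?R - ?T)"
    then have ij: "i < ?d" "j < ?d" using R by auto
    have "i = j" if "i div 2 = j div 2" "i mod 2 = j mod 2"
      using that by (metis mult_div_mod_eq)
    then show "Matrix.mat ?d ?d (\<lambda>(i, j). s i * J $$ (i, j)) $$ (i, j) = (?R - ?T) $$ (i, j)"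
      using ij R by (auto simp: Jij s_def block_rotation_index rot_block_index_mod)
  qed (use R in auto)
  \<comment> \<open>A matrix commuting with \<open>?R\<close> commutes with its inverse
    \<open>?T\<close>.\<close>
  have "?T * g = ?T * (g * ?R) * ?T"
    using assoc_mult_mat[OF R(2) mult_carrier_square[OF gc(1) R(1)] R(2)] assoc_mult_mat[OF gc(1) R(1,2)]
      R(3) gc(1) by simp
  also have "\<dots> = g * ?T"
    unfolding com assoc_mult_mat[OF R(2,1) gc(1), symmetric] R(4) using gc(1) by simp
  finally have "g * (?R - ?T) = (?R - ?T) * g"
    using mult_minus_distrib_mat[OF gc(1) R(1,2)] minus_mult_distrib_mat[OF R(1,2) gc(1)] com by simp
  then have gK: "g * (mat_diag ?d s * J) = (mat_diag ?d s * J) * g" by (simp add: K)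
  have "0 < s i" if "i < ?d" for i
  proof -
    have "ts ! (i div 2) \<in> set ts" using that by simp
    then have "0 < ts ! (i div 2)" "ts ! (i div 2) < 1/2" using ts by auto
    then show ?thesis unfolding s_def by (intro mult_pos_pos sin_gt_zero) auto
  qed
  from commutes_scaled_complex_structure[OF gc(1) J JJ this DJ gK]
  have "0 \<le> Determinant.det g" by (intro det_commutes_complex_structure[OF gc(1) J JJ]) simp
  then show ?thesis using det_orth[OF g] by auto
qed

subsection \<open>Angle multisets\<close>

lemma cos_2pi_inj:
  assumes "t \<in> {0..1/2}" "u \<in> {0..1/2}" "cos (2 * pi * t) = cos (2 * pi * u)"
  shows "t = u"
proof -
  have "0 \<le> 2 * pi * t" "2 * pi * t \<le> pi" "0 \<le> 2 * pi * u" "2 * pi * u \<le> pi" using assms by auto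
  from cos_inj_pi[OF this assms(3)] show ?thesis by simp
qed

text \<open>Each angle of \<open>M\<close> gives a root of the product over \<open>N\<close>, hence
  an angle of \<open>N\<close> with the same cosine, which is the same angle since the cosine is
  injective on this range. The common factor is cancelled; a nonempty remainder would make a
  quadratic divide 1.\<close>

lemma angle_poly_prod_inject:
  assumes "set_mset M \<subseteq> {0..1/2}" "set_mset N \<subseteq> {0..1/2}"
    and "(\<Prod>t\<in>#M. angle_poly t) = (\<Prod>t\<in>#N. angle_poly t)"
  shows "M = N"
  using assms
proof (induction M arbitrary: N)
  case empty
  show ?case
  proof (rule ccontr)
    assume "{#} \<noteq> N"
    then obtain u N' where N: "N = add_mset u N'" by (metis multiset_cases)
    have "1 = angle_poly u * (\<Prod>t\<in>#N'. angle_poly t)" using empty(3) unfolding N by simp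
    then have "angle_poly u dvd 1" by (metis dvd_triv_left)
    moreover have "angle_poly u \<noteq> 0" "degree (angle_poly u) = 2" by (simp_all add: angle_poly_def)
    ultimately show False by (simp add: is_unit_iff_degree)
  qed
next
  case (add t M)
  interpret h: map_poly_comm_ring_hom complex_of_real ..
  let ?P = "\<lambda>M. map_poly complex_of_real (\<Prod>t\<in>#M. angle_poly t)"
  have root: "poly (?P M) z = 0 \<Longrightarrow> \<exists>u\<in>#M. cos (2 * pi * u) = Re z" for M z
  proof (induction M)
    case empty
    then show ?case by simp
  next
    case (add u M)
    then have "poly (map_poly complex_of_real (angle_poly u)) z = 0 \<or> poly (?P M) z = 0"
      by (simp add: h.hom_mult)
    then show ?case using add.IH by (auto simp: poly_angle_poly_complex)
  qed
  have "poly (?P (add_mset t M)) (cis (2 * pi * t)) = 0"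
    by (simp add: h.hom_mult poly_angle_poly_complex)
  then have "poly (?P N) (cis (2 * pi * t)) = 0" by (simp only: add.prems(3))
  then obtain u where u: "u \<in># N" "cos (2 * pi * u) = cos (2 * pi * t)"
    using root[of N "cis (2 * pi * t)"] by auto
  then have "u = t" using cos_2pi_inj[of u t] add.prems(1,2) by auto
  then obtain N' where N: "N = add_mset t N'" using u(1) by (metis mset_add)
  have "angle_poly t * (\<Prod>t\<in>#M. angle_poly t) = angle_poly t * (\<Prod>t\<in>#N'. angle_poly t)"
    using add.prems(3) unfolding N by simp
  moreover have "angle_poly t \<noteq> 0" by (simp add: angle_poly_def)
  ultimately have "(\<Prod>t\<in>#M. angle_poly t) = (\<Prod>t\<in>#N'. angle_poly t)" by simp
  then have "M = N'" using add.IH[of N'] add.prems(1,2) unfolding N by simp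
  then show ?case by (simp add: N)
qed

section \<open>Powers of block rotations and the torsion condition\<close>

lemma rot_block_pow: "rot_block t ^\<^sub>m k = rot_block (real k * t)"
proof (induction k)
  case (Suc k)
  then show ?case by (simp add: rot_block_mult algebra_simps)
qed (simp add: rot_block_0)

lemma block_rotation_pow: "block_rotation ts ^\<^sub>m k = block_rotation (map (\<lambda>t. real k * t) ts)"
  unfolding block_rotation_def
  by (subst diag_block_pow_mat) (auto simp: rot_block_pow o_def)

lemma rot_block_eq_one_iff: "rot_block t = 1\<^sub>m 2 \<longleftrightarrow> t \<in> \<int>"
proof
  assume "rot_block t = 1\<^sub>m 2"
  then have "rot_block t $$ (0, 0) = 1\<^sub>m 2 $$ (0, 0)" by simp
  then have "cos (2 * pi * t) = 1" by simp
  then obtain n :: int where "2 * pi * t = of_int n * 2 * pi" by (auto simp: cos_one_2pi_int)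
  then have "t = of_int n" by simp
  then show "t \<in> \<int>" by simp
next
  assume "t \<in> \<int>"
  then obtain n :: int where "t = of_int n" by (auto elim: Ints_cases)
  then show "rot_block t = 1\<^sub>m 2"
    by (intro mat_2x2_eqI) (simp_all add: sin_int_2pin cos_int_2pin)
qed

lemma block_rotation_eq_one_iff:
  "block_rotation ts = 1\<^sub>m (2 * length ts) \<longleftrightarrow> set ts \<subseteq> \<int>"
proof (induction ts)
  case (Cons t ts)
  have "block_rotation (t # ts) = 1\<^sub>m (2 * length (t # ts)) \<longleftrightarrow>
      dsum (rot_block t) (block_rotation ts) = dsum (1\<^sub>m 2) (1\<^sub>m (2 * length ts))"
    by (simp add: block_rotation_Cons dsum_one)
  also have "\<dots> \<longleftrightarrow> rot_block t = 1\<^sub>m 2 \<and> block_rotation ts = 1\<^sub>m (2 * length ts)"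
    by (auto dest: dsum_inject[OF rot_block_carrier block_rotation_carrier one_carrier_mat one_carrier_mat])
  finally show ?case by (simp add: Cons.IH rot_block_eq_one_iff)
qed (simp add: block_rotation_Nil)

lemma conj_pow:
  assumes P: "P \<in> orth d" and A: "A \<in> carrier_mat d d"
  shows "(P * A * transpose_mat P) ^\<^sub>m k = P * A ^\<^sub>m k * transpose_mat P"
proof (induction k)
  case 0
  then show ?case using orthD[OF P] A by simp
next
  case (Suc k)
  note c = orthD[OF P]
  have Ak: "A ^\<^sub>m k \<in> carrier_mat d d" using A by simp
  have "(P * A ^\<^sub>m k * transpose_mat P) * (P * A * transpose_mat P) =
      (P * A ^\<^sub>m k) * (transpose_mat P * (P * A * transpose_mat P))"
    by (rule assoc_mult_mat[OF mult_carrier_square[OF c(1) Ak] c(2)]) (use c A in auto)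
  also have "transpose_mat P * (P * A * transpose_mat P) = A * transpose_mat P"
    using assoc_mult_mat[OF c(2) mult_carrier_square[OF c(1) A] c(2)] assoc_mult_mat[OF c(2,1) A] c(4) A
    by simp
  also have "(P * A ^\<^sub>m k) * (A * transpose_mat P) = P * (A ^\<^sub>m k * A) * transpose_mat P"
    using assoc_mult_mat[OF mult_carrier_square[OF c(1) Ak] A c(2)] assoc_mult_mat[OF c(1) Ak A] by simp
  finally show ?case by (simp add: Suc.IH)
qed

lemma conj_eq_one_iff:
  assumes P: "P \<in> orth d" and A: "A \<in> carrier_mat d d"
  shows "P * A * transpose_mat P = 1\<^sub>m d \<longleftrightarrow> A = 1\<^sub>m d"
proof
  assume "P * A * transpose_mat P = 1\<^sub>m d"
  from conj_inverse[OF P A this[symmetric]] show "A = 1\<^sub>m d" using orthD[OF P] by simp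
qed (use orthD[OF P] in simp)

lemma SO_nat_pow:
  assumes "A \<in> carrier_mat d d"
  shows "A [^]\<^bsub>SO d\<^esub> (k :: nat) = A ^\<^sub>m k"
proof (induction k)
  case 0
  show ?case using assms by (simp add: SO_def)
next
  case (Suc k)
  then show ?case by (simp add: SO_def)
qed

lemma conj_block_rotation_pow_eq_one_iff:
  assumes "P \<in> orth (2 * length ts)"
  shows "(P * block_rotation ts * transpose_mat P) [^]\<^bsub>SO (2 * length ts)\<^esub> (m :: nat)
      = \<one>\<^bsub>SO (2 * length ts)\<^esub> \<longleftrightarrow> (\<forall>t\<in>set ts. real m * t \<in> \<int>)"
proof -
  note R = block_rotation_carrier[of ts]
  have "P * block_rotation ts * transpose_mat P \<in> carrier_mat (2 * length ts) (2 * length ts)"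
    using orthD[OF assms] R by auto
  then show ?thesis
    using conj_pow[OF assms R, of m] conj_eq_one_iff[OF assms pow_carrier_mat[OF R], of m]
      block_rotation_eq_one_iff[of "map (\<lambda>t. real m * t) ts"]
    by (auto simp: SO_nat_pow block_rotation_pow) (simp_all add: SO_def image_subset_iff)
qed

lemma conj_eigenpairs_cong:
  assumes "A \<in> carrier_mat d d" "B \<in> carrier_mat d d" "char_poly A = char_poly B"
  shows "conj_eigenpairs A = conj_eigenpairs B"
proof -
  have "char_poly (map_mat complex_of_real A) = char_poly (map_mat complex_of_real B)"
    using of_real_hom.char_poly_hom[OF assms(1), where ?'a = complex]
      of_real_hom.char_poly_hom[OF assms(2), where ?'a = complex] assms(3) by simp
  then show ?thesis
    using assms(1,2) by (simp add: conj_eigenpairs_def spectrum_root_char_poly[of _ d])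
qed

text \<open>Since \<open>conj_eigenpairs\<close> depends only on the characteristic polynomial,
  \<open>A\<close> may be replaced by the block rotation. That is
  \<open>card_conj_eigenpairs\<close> for the unit element, and folding does nothing to angles
  already in range.\<close>

lemma card_conj_eigenpairs_folded:
  assumes A: "A \<in> carrier_mat (2 * length ts) (2 * length ts)"
    and cp: "char_poly A = (\<Prod>t\<leftarrow>ts. angle_poly t)" and ts: "set ts \<subseteq> {0..1/2}"
  shows "card (conj_eigenpairs A) = card (set ts)"
proof -
  let ?G = "SO (2 * length ts)"
  have one: "\<one>\<^bsub>?G\<^esub> \<in> carrier ?G" using group.is_monoid[OF group_SO] by (rule monoid.one_closed)
  have "folded_angle t = t" if "t \<in> set ts" for t
    using cos_2pi_inj[of "folded_angle t" t] cos_folded_angle[of t] folded_angle_props(1,2)[of t] ts that by auto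
  then have "folded_angle ` set ts = set ts" by force
  moreover have "\<one>\<^bsub>?G\<^esub> \<otimes>\<^bsub>?G\<^esub> block_rotation ts \<otimes>\<^bsub>?G\<^esub> inv\<^bsub>?G\<^esub> \<one>\<^bsub>?G\<^esub> = block_rotation ts"
    using group.is_monoid[OF group_SO] block_rotation_SO[of ts]
    by (simp add: monoid.inv_one monoid.l_one monoid.r_one)
  moreover have "conj_eigenpairs A = conj_eigenpairs (block_rotation ts)"
    by (rule conj_eigenpairs_cong[OF A block_rotation_carrier]) (simp add: cp char_poly_block_rotation)
  ultimately show ?thesis using card_conj_eigenpairs[OF one] by simp
qed

section \<open>Counting multisets by their support\<close>

text \<open>Deleting one copy of \<open>x\<close> either keeps the support or removes
  \<open>x\<close> from it. This is the recursion behind Pascal's rule.\<close>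

lemma multisets_with_set_Suc:
  assumes "x \<in> S"
  shows "{M. set_mset M = S \<and> size M = Suc n} =
    add_mset x ` ({M. set_mset M = S \<and> size M = n} \<union> {M. set_mset M = S - {x} \<and> size M = n})"
    (is "?L = ?R")
proof
  show "?L \<subseteq> ?R"
  proof
    fix M assume M: "M \<in> ?L"
    then obtain N where N: "M = add_mset x N" using assms by (metis (mono_tags) mem_Collect_eq mset_add)
    with M assms have "set_mset N = S \<or> set_mset N = S - {x}" "size N = n" by auto
    then show "M \<in> ?R" unfolding N by blast
  qed
  show "?R \<subseteq> ?L"
  proof
    fix M assume "M \<in> ?R"
    then obtain N where "M = add_mset x N" "set_mset N = S \<or> set_mset N = S - {x}" "size N = n" by blast
    then show "M \<in> ?L" using assms by (auto simp only: mem_Collect_eq set_mset_add_mset_insert size_add_mset insert_absorb insert_Diff)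
  qed
qed

text \<open>The multiplicities form a composition of \<open>Suc n\<close> into \<open>card S\<close>
  positive parts. The empty support is treated apart because truncated subtraction would turn the
  binomial coefficient into 1 there.\<close>

lemma multisets_with_set:
  assumes "finite S"
  shows "finite {M. set_mset M = S \<and> size M = Suc n} \<and>
    card {M. set_mset M = S \<and> size M = Suc n} = (if S = {} then 0 else n choose (card S - 1))"
  using assms
proof (induction n arbitrary: S)
  case 0
  have "{M. set_mset M = S \<and> size M = Suc 0} = (if card S = 1 then {{#the_elem S#}} else {})"
    by (auto simp: card_1_singleton_iff dest!: size_1_singleton_mset[OF trans[OF _ One_nat_def[symmetric]]])
  moreover have "card S = (if S = {} then 0 else Suc (card S - 1))"
    using 0 by (cases "card S") auto
  ultimately show ?case by (cases "card S - 1") (auto split: if_splits)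
next
  case (Suc n)
  show ?case
  proof (cases "S = {}")
    case True
    then have "{M. set_mset M = S \<and> size M = Suc (Suc n)} = {}" by auto
    then show ?thesis using True by simp
  next
    case False
    then obtain x where x: "x \<in> S" by blast
    let ?A = "{M. set_mset M = S \<and> size M = Suc n}" and ?B = "{M. set_mset M = S - {x} \<and> size M = Suc n}"
    have A: "finite ?A" "card ?A = n choose (card S - 1)" using Suc.IH[OF Suc.prems] False by auto
    have B: "finite ?B" "card ?B = (if S - {x} = {} then 0 else n choose (card (S - {x}) - 1))"
      using Suc.IH[of "S - {x}"] Suc.prems by auto
    have "card (?A \<union> ?B) = card ?A + card ?B"
      by (rule card_Un_disjoint[OF A(1) B(1)]) (use x in auto)
    also have "\<dots> = Suc n choose (card S - 1)"
    proof (cases "S = {x}")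
      case True
      then show ?thesis unfolding A(2) B(2) by simp
    next
      case F: False
      then have "S - {x} \<noteq> {}" using x by auto
      then have "card (S - {x}) \<noteq> 0" using Suc.prems by (metis card_0_eq finite_Diff)
      then obtain c where c: "card (S - {x}) = Suc c" by (cases "card (S - {x})") auto
      then have "card S = Suc (Suc c)" using x Suc.prems by (metis card_Suc_Diff1)
      then show ?thesis using c F x A(2) B(2) by auto
    qed
    finally have "card (?A \<union> ?B) = Suc n choose (card S - 1)" .
    moreover have "inj_on (add_mset x) (?A \<union> ?B)" by (simp add: inj_on_def)
    ultimately show ?thesis
      using False A(1) B(1) unfolding multisets_with_set_Suc[OF x, of "Suc n"]
      by (simp add: card_image)
  qed
qed

text \<open>The support is chosen first, then the multiplicities on it.\<close>

lemma multisets_with_support_card: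
  assumes T: "finite T" and n: "0 < n" and s: "0 < s"
  shows "finite {M. set_mset M \<subseteq> T \<and> card (set_mset M) = s \<and> size M = n} \<and>
    card {M. set_mset M \<subseteq> T \<and> card (set_mset M) = s \<and> size M = n} =
      (card T choose s) * ((n - 1) choose (s - 1))"
proof -
  obtain n' where n': "n = Suc n'" using n by (cases n) auto
  let ?F = "{S. S \<subseteq> T \<and> card S = s}" and ?X = "\<lambda>S. {M. set_mset M = S \<and> size M = n}"
  have eq: "{M. set_mset M \<subseteq> T \<and> card (set_mset M) = s \<and> size M = n} = (\<Union>S\<in>?F. ?X S)" by auto
  have F: "finite ?F" using T by simp
  have X: "finite (?X S)" "card (?X S) = (n - 1) choose (s - 1)" if "S \<in> ?F" for S
    using multisets_with_set[of S n'] that s finite_subset[OF _ T, of S] unfolding n' by auto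
  have "card (\<Union>S\<in>?F. ?X S) = (\<Sum>S\<in>?F. card (?X S))"
    by (rule card_UN_disjoint) (use F X in auto)
  also have "\<dots> = (card T choose s) * ((n - 1) choose (s - 1))"
    using X(2) n_subsets[OF T, of s] by simp
  finally show ?thesis unfolding eq using F X(1) by auto
qed

section \<open>Angles of elements of order dividing \<open>m\<close>\<close>

text \<open>Multiplication by \<open>m\<close> stretches the interval to length \<open>k\<close>, so
  the admissible angles are the integer points from 0 to \<open>k\<close>. Excluding both endpoints,
  the angles of real eigenvalues, leaves \<open>k - 1\<close> of the \<open>k + 1\<close>
  points.\<close>

lemma torsion_angles:
  assumes m: "m = 2 * k" "0 < k"
  shows "{t \<in> {0..1/2}. real m * t \<in> \<int>} = (\<lambda>j. real j / real m) ` {..k}"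
    and "{t \<in> {0<..<1/2}. real m * t \<in> \<int>} = (\<lambda>j. real j / real m) ` {0<..<k}"
proof -
  have *: "t \<in> (\<lambda>j. real j / real m) ` J \<longleftrightarrow> (\<exists>j\<in>J. real m * t = real j)" for t J
    using m by (auto simp: image_iff field_simps)
  have nat: "\<exists>j. real m * t = real j" if t: "real m * t \<in> \<int>" "0 \<le> t" for t
  proof -
    obtain i :: int where i: "real m * t = of_int i" using t by (auto elim: Ints_cases)
    moreover have "0 \<le> real m * t" using t by simp
    ultimately have "0 \<le> i" by simp
    then show ?thesis using i by (intro exI[of _ "nat i"]) simp
  qed
  have le: "t \<le> 1/2 \<longleftrightarrow> j \<le> k" "t < 1/2 \<longleftrightarrow> j < k" "0 \<le> t \<longleftrightarrow> 0 \<le> j" "0 < t \<longleftrightarrow> 0 < j"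
    if "real m * t = real j" for t j
  proof -
    have t: "t = real j / (2 * real k)" using that m by (auto simp: field_simps)
    show "t \<le> 1/2 \<longleftrightarrow> j \<le> k" "t < 1/2 \<longleftrightarrow> j < k" "0 \<le> t \<longleftrightarrow> 0 \<le> j" "0 < t \<longleftrightarrow> 0 < j"
      unfolding t using m by (auto simp: field_simps)
  qed
  have int: "real m * t \<in> \<int>" if "real m * t = real j" for t j using that by simp
  show "{t \<in> {0..1/2}. real m * t \<in> \<int>} = (\<lambda>j. real j / real m) ` {..k}"
  proof (intro equalityI subsetI)
    fix t assume "t \<in> {t \<in> {0..1/2}. real m * t \<in> \<int>}"
    then obtain j where j: "real m * t = real j" "t \<le> 1/2" using nat[of t] by auto
    then show "t \<in> (\<lambda>j. real j / real m) ` {..k}" unfolding * using le(1)[OF j(1)] by auto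
  next
    fix t assume "t \<in> (\<lambda>j. real j / real m) ` {..k}"
    then obtain j where j: "real m * t = real j" "j \<le> k" unfolding * by auto
    then show "t \<in> {t \<in> {0..1/2}. real m * t \<in> \<int>}" using le[OF j(1)] int[OF j(1)] by simp
  qed
  show "{t \<in> {0<..<1/2}. real m * t \<in> \<int>} = (\<lambda>j. real j / real m) ` {0<..<k}"
  proof (intro equalityI subsetI)
    fix t assume t: "t \<in> {t \<in> {0<..<1/2}. real m * t \<in> \<int>}"
    then obtain j where j: "real m * t = real j" using nat[of t] by auto
    then show "t \<in> (\<lambda>j. real j / real m) ` {0<..<k}" unfolding * using le[OF j] t by auto
  next
    fix t assume "t \<in> (\<lambda>j. real j / real m) ` {0<..<k}"
    then obtain j where j: "real m * t = real j" "0 < j" "j < k" unfolding * by auto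
    then show "t \<in> {t \<in> {0<..<1/2}. real m * t \<in> \<int>}" using le[OF j(1)] int[OF j(1)] by simp
  qed
qed

lemma card_torsion_angles:
  assumes "m = 2 * k" "0 < k"
  shows "finite {t \<in> {0..1/2}. real m * t \<in> \<int>}" "card {t \<in> {0..1/2}. real m * t \<in> \<int>} = k + 1"
    "finite {t \<in> {0<..<1/2}. real m * t \<in> \<int>}" "card {t \<in> {0<..<1/2}. real m * t \<in> \<int>} = k - 1"
proof -
  have inj: "inj_on (\<lambda>j. real j / real m) J" for J :: "nat set" using assms by (auto simp: inj_on_def)
  show "finite {t \<in> {0..1/2}. real m * t \<in> \<int>}" "card {t \<in> {0..1/2}. real m * t \<in> \<int>} = k + 1"
    "finite {t \<in> {0<..<1/2}. real m * t \<in> \<int>}" "card {t \<in> {0<..<1/2}. real m * t \<in> \<int>} = k - 1"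
    unfolding torsion_angles[OF assms] by (simp_all add: card_image[OF inj])
qed

subsection \<open>Conjugacy classes\<close>

lemma SO_mult_closed:
  assumes "g \<in> carrier (SO d)" "h \<in> carrier (SO d)"
  shows "g * h \<in> carrier (SO d)"
  using monoid.m_closed[OF group.is_monoid[OF group_SO] assms] by (simp add: SO_def)

lemma det_orth_mult:
  assumes "P \<in> orth d" "Q \<in> orth d"
  shows "Determinant.det (P * Q) = Determinant.det P * Determinant.det Q"
  using assms by (auto simp: orth_def intro: Determinant.det_mult)

text \<open>Replaces the orbit of the restricted group action, with its abstract inverse, by plain
  matrix products; \<open>conj_classes_SO\<close> is the bridge.\<close>

definition SO_class :: "nat \<Rightarrow> real mat \<Rightarrow> real mat set" where
  "SO_class d A = (\<lambda>g. g * A * transpose_mat g) ` carrier (SO d)"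

lemma conj_classes_SO: "conj_classes (SO d) = SO_class d ` carrier (SO d)"
proof -
  have "orbit (SO d) (\<lambda>g. \<lambda>h\<in>carrier (SO d). g \<otimes>\<^bsub>SO d\<^esub> h \<otimes>\<^bsub>SO d\<^esub> inv\<^bsub>SO d\<^esub> g) A = SO_class d A"
    if "A \<in> carrier (SO d)" for A
  proof -
    have "g \<otimes>\<^bsub>SO d\<^esub> A \<otimes>\<^bsub>SO d\<^esub> inv\<^bsub>SO d\<^esub> g = g * A * transpose_mat g" if "g \<in> carrier (SO d)" for g
      unfolding SO_inv[OF that] by (simp add: SO_def)
    then show ?thesis
      unfolding orbit_def SO_class_def Setcompr_eq_image Collect_mem_eq
      using that by (intro image_cong) simp_all
  qed
  then show ?thesis unfolding conj_classes_def orbits_def by auto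
qed

lemma SO_class_conj_subset:
  assumes h: "h \<in> carrier (SO d)" and A: "A \<in> carrier_mat d d"
  shows "SO_class d (h * A * transpose_mat h) \<subseteq> SO_class d A"
proof
  fix B assume "B \<in> SO_class d (h * A * transpose_mat h)"
  then obtain g where g: "g \<in> carrier (SO d)" and B: "B = g * (h * A * transpose_mat h) * transpose_mat g"
    by (auto simp: SO_class_def)
  have "B = (g * h) * A * transpose_mat (g * h)"
    unfolding B by (rule conj_conj_mat[OF _ _ A]) (use g h in \<open>auto simp: SO_carrier_iff\<close>)
  then show "B \<in> SO_class d A" using SO_mult_closed[OF g h] by (auto simp: SO_class_def)
qed

lemma SO_class_conj:
  assumes h: "h \<in> carrier (SO d)" and A: "A \<in> carrier_mat d d"
  shows "SO_class d (h * A * transpose_mat h) = SO_class d A"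
proof
  have ho: "h \<in> orth d" using h by (simp add: SO_iff_orth)
  let ?B = "h * A * transpose_mat h"
  have B: "?B \<in> carrier_mat d d" using orthD[OF ho] A by auto
  have "A = transpose_mat h * ?B * transpose_mat (transpose_mat h)"
    using conj_inverse[OF ho A refl] by simp
  then show "SO_class d A \<subseteq> SO_class d ?B"
    using SO_class_conj_subset[OF SO_transpose_closed[OF h] B] by simp
qed (rule SO_class_conj_subset[OF h A])

lemma SO_class_self: "A \<in> carrier_mat d d \<Longrightarrow> A \<in> SO_class d A"
  unfolding SO_class_def by (rule image_eqI[of _ _ "1\<^sub>m d"]) (auto simp: SO_iff_orth)

lemma householder_smult:
  assumes "e = 1 \<or> e = (-1 :: real)" "x \<in> carrier_vec d"
  shows "householder d (e \<cdot>\<^sub>v x) = householder d x"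
  using assms by (auto simp: householder_def)

text \<open>\<open>A\<close> maps the line through \<open>x\<close> to itself, and a reflection
  depends only on the line it negates, so conjugation by \<open>A\<close> leaves the reflection in
  \<open>x\<close> unchanged.\<close>

lemma commuting_reflection:
  assumes A: "A \<in> orth d" and d: "0 < d" and e: "e = 1 \<or> e = -1"
    and x: "x \<in> carrier_vec d" "x \<bullet> x = 1" "A *\<^sub>v x = e \<cdot>\<^sub>v x"
  obtains Q where "Q \<in> orth d" "Determinant.det Q = -1" "Q * A * transpose_mat Q = A"
proof -
  note c = orthD[OF A]
  let ?H = "householder d x"
  have H: "?H \<in> orth d" by (rule householder_orth[OF x(1)])
  note Hc = orthD[OF H]
  have "A * ?H * transpose_mat A = ?H"
    using conj_householder[OF A x(1)] x(3) householder_smult[OF e x(1)] by simp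
  then have "?H * A = A * ?H * (transpose_mat A * A)"
    using assoc_mult_mat[OF mult_carrier_square[OF c(1) Hc(1)] c(2,1)] by simp
  then have "?H * A = A * ?H" unfolding c(4) using c(1) Hc(1) by simp
  then have "?H * A * transpose_mat ?H = A"
    using assoc_mult_mat[OF c(1) Hc(1,2)] Hc(3) c(1) by simp
  with H det_householder[OF x(1,2) d] show thesis by (rule that)
qed

section \<open>Representatives indexed by angle multisets\<close>

text \<open>Sorting merely chooses one ordering, so that each multiset of angles has a single
  representing matrix.\<close>

definition rotation_of :: "real multiset \<Rightarrow> real mat" where
  "rotation_of M = block_rotation (sorted_list_of_multiset M)"

lemma length_sorted_list_of_multiset: "length (sorted_list_of_multiset M) = size M"
  by (metis mset_sorted_list_of_multiset size_mset)

lemma rotation_of_SO: "rotation_of M \<in> carrier (SO (2 * size M))"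
  using block_rotation_SO[of "sorted_list_of_multiset M"]
  by (simp add: rotation_of_def length_sorted_list_of_multiset)

lemma rotation_of_carrier [simp]: "rotation_of M \<in> carrier_mat (2 * size M) (2 * size M)"
  using rotation_of_SO[of M] by (simp add: SO_carrier_iff)

lemma char_poly_rotation_of: "char_poly (rotation_of M) = (\<Prod>t\<in>#M. angle_poly t)"
  unfolding rotation_of_def char_poly_block_rotation
  by (metis mset_map mset_sorted_list_of_multiset prod_mset_prod_list)

lemma SO_normal_form:
  assumes A: "A \<in> carrier (SO (2 * n))"
  obtains M P where "size M = n" "set_mset M \<subseteq> {0..1/2}" "P \<in> orth (2 * n)"
    "A = P * rotation_of M * transpose_mat P"
proof -
  obtain ts where ts: "length ts = n" "set ts \<subseteq> {0..1/2}" "char_poly A = (\<Prod>t\<leftarrow>ts. angle_poly t)"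
    using SO_char_poly[OF A] by blast
  let ?us = "sorted_list_of_multiset (mset ts)"
  have us: "length ?us = n" using ts(1) by (simp add: length_sorted_list_of_multiset)
  have "char_poly A = (\<Prod>t\<in>#mset ts. angle_poly t)"
    unfolding ts(3) by (metis mset_map prod_mset_prod_list)
  also have "\<dots> = (\<Prod>t\<leftarrow>?us. angle_poly t)"
    by (metis mset_map mset_sorted_list_of_multiset prod_mset_prod_list)
  finally obtain P where "P \<in> orth (2 * n)" "A = P * block_rotation ?us * transpose_mat P"
    using conj_block_rotation[of A ?us] A us by auto
  then show thesis using that[of "mset ts" P] ts by (simp add: rotation_of_def)
qed

lemma rotation_of_conj_torsion_iff:
  assumes M: "size M = n" "set_mset M \<subseteq> {0..1/2}" and P: "P \<in> orth (2 * n)"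
    and A: "A = P * rotation_of M * transpose_mat P"
  shows "A [^]\<^bsub>SO (2 * n)\<^esub> (m :: nat) = \<one>\<^bsub>SO (2 * n)\<^esub> \<longleftrightarrow> (\<forall>t\<in>#M. real m * t \<in> \<int>)"
    and "card (conj_eigenpairs A) = card (set_mset M)"
proof -
  let ?ts = "sorted_list_of_multiset M"
  have l: "length ?ts = n" using M(1) by (simp add: length_sorted_list_of_multiset)
  show "A [^]\<^bsub>SO (2 * n)\<^esub> (m :: nat) = \<one>\<^bsub>SO (2 * n)\<^esub> \<longleftrightarrow> (\<forall>t\<in>#M. real m * t \<in> \<int>)"
    using conj_block_rotation_pow_eq_one_iff[of P ?ts m] P l unfolding A rotation_of_def by simp
  have R: "rotation_of M \<in> carrier_mat (2 * n) (2 * n)" using rotation_of_carrier[of M] M(1) by simp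
  have Ac: "A \<in> carrier_mat (2 * n) (2 * n)" unfolding A using orthD[OF P] R by auto
  have "char_poly A = (\<Prod>t\<leftarrow>?ts. angle_poly t)"
    unfolding A char_poly_conj[OF P R] by (simp add: rotation_of_def char_poly_block_rotation)
  then show "card (conj_eigenpairs A) = card (set_mset M)"
    using card_conj_eigenpairs_folded[of A ?ts] Ac M(2) l by simp
qed

lemma rotation_of_commuting_reflection:
  assumes M: "size M = n" "0 \<in># M \<or> 1/2 \<in># M"
  obtains Q where "Q \<in> orth (2 * n)" "Determinant.det Q = -1" "Q * rotation_of M * transpose_mat Q = rotation_of M"
proof -
  let ?R = "rotation_of M"
  have n: "0 < 2 * n" using M by (auto simp: size_eq_0_iff_empty simp flip: M(1) neq0_conv)
  have R: "?R \<in> orth (2 * n)" using rotation_of_SO[of M] M(1) by (simp add: SO_iff_orth)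
  obtain t where t: "t \<in># M" "t = 0 \<or> t = 1/2" using M(2) by auto
  define e where "e = cos (2 * pi * t)"
  have e: "e = 1 \<or> e = -1" "cis (2 * pi * t) = of_real e"
    unfolding e_def using t(2) by (elim disjE; hypsubst; simp add: complex_eq_iff)+
  have "cis (2 * pi * t) \<in> spectrum (map_mat complex_of_real ?R)"
    unfolding rotation_of_def spectrum_block_rotation using t(1) by auto
  then have "eigenvalue (map_mat complex_of_real ?R) (of_real e)" by (simp add: spectrum_def e(2))
  then obtain x where "x \<in> carrier_vec (2 * n)" "x \<bullet> x = 1" "?R *\<^sub>v x = e \<cdot>\<^sub>v x"
    by (rule real_eigenvector_of_complex[OF orthD(1)[OF R]])
  then show thesis using commuting_reflection[OF R n e(1)] that by blast
qed

lemma rotation_of_centralizer: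
  assumes M: "size M = n" "set_mset M \<subseteq> {0<..<1/2}" and Q: "Q \<in> orth (2 * n)"
    and e: "Q * rotation_of M * transpose_mat Q = rotation_of M"
  shows "Determinant.det Q = 1"
proof -
  let ?ts = "sorted_list_of_multiset M" and ?R = "rotation_of M"
  have l: "length ?ts = n" using M(1) by (simp add: length_sorted_list_of_multiset)
  have R: "?R \<in> carrier_mat (2 * n) (2 * n)" using rotation_of_carrier[of M] M(1) by simp
  note c = orthD[OF Q]
  have "Q * ?R * (transpose_mat Q * Q) = ?R * Q"
    using assoc_mult_mat[OF mult_carrier_square[OF c(1) R] c(2,1)] e by simp
  then have "Q * ?R = ?R * Q" unfolding c(4) right_mult_one_mat[OF mult_carrier_square[OF c(1) R]] .
  moreover have "0 < t \<and> t < 1/2" if "t \<in> set ?ts" for t using M(2) that by auto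
  ultimately show ?thesis
    using det_centralizer_block_rotation[of Q ?ts] Q l unfolding rotation_of_def by blast
qed

text \<open>The characteristic polynomial does not see the determinant of a conjugator. Hence the
  same statement gives injectivity for the classes of the rotations and of their mirror images, and
  reduces any coincidence between the two families to equal multisets.\<close>

lemma conj_rotation_of_inject:
  assumes M: "size M = n" "set_mset M \<subseteq> {0..1/2}" and N: "size N = n" "set_mset N \<subseteq> {0..1/2}"
    and P: "P \<in> orth (2 * n)" and Q: "Q \<in> orth (2 * n)"
    and e: "SO_class (2 * n) (P * rotation_of M * transpose_mat P) = SO_class (2 * n) (Q * rotation_of N * transpose_mat Q)"
  shows "M = N"
proof -
  let ?A = "P * rotation_of M * transpose_mat P" and ?B = "Q * rotation_of N * transpose_mat Q"
  have R: "rotation_of M \<in> carrier_mat (2 * n) (2 * n)" "rotation_of N \<in> carrier_mat (2 * n) (2 * n)"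
    using rotation_of_carrier[of M] rotation_of_carrier[of N] M(1) N(1) by simp_all
  have AB: "?A \<in> carrier_mat (2 * n) (2 * n)" "?B \<in> carrier_mat (2 * n) (2 * n)"
    using orthD[OF P] orthD[OF Q] R by auto
  obtain g where g: "g \<in> carrier (SO (2 * n))" "?A = g * ?B * transpose_mat g"
    using SO_class_self[OF AB(1)] unfolding e by (auto simp: SO_class_def)
  have "char_poly ?A = char_poly ?B"
    unfolding g(2) by (rule char_poly_conj[OF _ AB(2)]) (use g in \<open>simp add: SO_iff_orth\<close>)
  then have "char_poly (rotation_of M) = char_poly (rotation_of N)"
    by (simp add: char_poly_conj[OF P R(1)] char_poly_conj[OF Q R(2)])
  then show ?thesis
    using angle_poly_prod_inject[OF M(2) N(2)] by (simp add: char_poly_rotation_of)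
qed

definition angle_multisets :: "nat \<Rightarrow> nat \<Rightarrow> real set \<Rightarrow> real multiset set" where
  "angle_multisets n s T = {M. set_mset M \<subseteq> T \<and> card (set_mset M) = s \<and> size M = n}"

lemma reflection_exists:
  assumes "0 < d"
  obtains F where "F \<in> orth d" "Determinant.det F = -1"
proof -
  let ?e = "unit_vec d 0 :: real vec"
  have "?e \<in> carrier_vec d" "?e \<bullet> ?e = 1" using assms by auto
  then show thesis using that householder_orth det_householder assms by blast
qed

section \<open>Enumeration of the torsion classes\<close>

text \<open>\<open>X\<close> lists the classes of the rotations and \<open>Y\<close> those of their
  images under one fixed \<open>F\<close> of determinant -1. The second list is restricted to
  \<open>T'\<close> because an angle 0 or 1/2 makes the mirror image conjugate to the
  original.\<close>

lemma SO_torsion_classes_eq: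
  fixes n m s :: nat
  assumes F: "F \<in> orth (2 * n)" "Determinant.det F = -1"
  defines "X \<equiv> \<lambda>M. SO_class (2 * n) (rotation_of M)"
    and "Y \<equiv> \<lambda>M. SO_class (2 * n) (F * rotation_of M * transpose_mat F)"
    and "T \<equiv> {t \<in> {0..1/2}. real m * t \<in> \<int>}" and "T' \<equiv> {t \<in> {0<..<1/2}. real m * t \<in> \<int>}"
  shows "SO_torsion_classes n m s = X ` angle_multisets n s T \<union> Y ` angle_multisets n s T'"
proof (intro equalityI subsetI)
  let ?d = "2 * n"
  note Fc = orthD[OF F(1)]
  fix C assume "C \<in> SO_torsion_classes n m s"
  then obtain A where A: "A \<in> carrier (SO ?d)" "C = SO_class ?d A"
    and C: "\<And>x. x \<in> C \<Longrightarrow> x [^]\<^bsub>SO ?d\<^esub> m = \<one>\<^bsub>SO ?d\<^esub> \<and> card (conj_eigenpairs x) = s"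
    by (auto simp: SO_torsion_classes_def conj_classes_SO)
  have "A \<in> C" unfolding A(2) using A(1) by (intro SO_class_self) (simp add: SO_carrier_iff)
  obtain M P where M: "size M = n" "set_mset M \<subseteq> {0..1/2}" and P: "P \<in> orth ?d"
    and AP: "A = P * rotation_of M * transpose_mat P"
    by (rule SO_normal_form[OF A(1)])
  have MT: "\<forall>t\<in>#M. real m * t \<in> \<int>" "card (set_mset M) = s"
    using C[OF \<open>A \<in> C\<close>] rotation_of_conj_torsion_iff[OF M P AP] by auto
  then have MX: "M \<in> angle_multisets n s T" using M by (auto simp: angle_multisets_def T_def)
  have R: "rotation_of M \<in> carrier_mat ?d ?d" using rotation_of_carrier[of M] M(1) by simp
  consider "Determinant.det P = 1" | "Determinant.det P = -1" "0 \<in># M \<or> 1/2 \<in># M"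
    | "Determinant.det P = -1" "0 \<notin># M" "1/2 \<notin># M" using det_orth[OF P] by blast
  then show "C \<in> X ` angle_multisets n s T \<union> Y ` angle_multisets n s T'"
  proof cases
    case 1
    then have "P \<in> carrier (SO ?d)" using P by (simp add: SO_iff_orth)
    then have "C = X M" unfolding A(2) AP X_def by (rule SO_class_conj[OF _ R])
    then show ?thesis using MX by blast
  next
    case 2
    \<comment> \<open>\<open>Q\<close> fixes the representative, so it can be absorbed into
      \<open>P\<close> to correct the sign of the determinant.\<close>
    obtain Q where Q: "Q \<in> orth ?d" "Determinant.det Q = -1" "Q * rotation_of M * transpose_mat Q = rotation_of M"
      by (rule rotation_of_commuting_reflection[OF M(1) 2(2)])
    have "A = (P * Q) * rotation_of M * transpose_mat (P * Q)"
      using conj_conj_mat[OF orthD(1)[OF P] orthD(1)[OF Q(1)] R] Q(3) by (simp add: AP)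
    moreover have "P * Q \<in> carrier (SO ?d)"
      using orth_mult[OF P Q(1)] det_orth_mult[OF P Q(1)] Q(2) 2(1) by (simp add: SO_iff_orth)
    ultimately have "C = X M" unfolding A(2) X_def by (simp add: SO_class_conj[OF _ R])
    then show ?thesis using MX by blast
  next
    case 3
    \<comment> \<open>Both factors have determinant -1, so \<open>?G\<close> lies in the special
      orthogonal group and carries the mirror image \<open>?B\<close> to \<open>A\<close>.\<close>
    let ?G = "P * transpose_mat F" and ?B = "F * rotation_of M * transpose_mat F"
    have FT: "transpose_mat F \<in> orth ?d" by (rule orth_transpose[OF F(1)])
    have B: "?B \<in> carrier_mat ?d ?d" using Fc R by auto
    have "rotation_of M = transpose_mat F * ?B * transpose_mat (transpose_mat F)"
      using conj_inverse[OF F(1) R refl] by simp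
    then have "A = ?G * ?B * transpose_mat ?G"
      using conj_conj_mat[OF orthD(1)[OF P] Fc(2) B] by (simp add: AP)
    moreover have "?G \<in> carrier (SO ?d)"
      using orth_mult[OF P FT] det_orth_mult[OF P FT] F(2) 3(1) Determinant.det_transpose[OF Fc(1)]
      by (simp add: SO_iff_orth)
    ultimately have "C = Y M" unfolding A(2) Y_def by (simp add: SO_class_conj[OF _ B])
    moreover have "t \<in> T'" if t: "t \<in># M" for t
    proof -
      have "t \<in> {0..1/2}" using t M(2) by blast
      moreover have "t \<noteq> 0" "t \<noteq> 1/2" using t 3(2,3) by metis+
      ultimately have "0 < t" "t < 1/2" by (simp_all add: less_le)
      then show ?thesis using t MT(1) by (simp add: T'_def)
    qed
    then have "M \<in> angle_multisets n s T'"
      using M(1) MT(2) by (auto simp: angle_multisets_def)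
    ultimately show ?thesis by blast
  qed
next
  let ?d = "2 * n"
  fix C assume C: "C \<in> X ` angle_multisets n s T \<union> Y ` angle_multisets n s T'"
  have "angle_multisets n s T' \<subseteq> angle_multisets n s T"
    by (auto simp: angle_multisets_def T_def T'_def subset_iff less_imp_le)
  moreover have "X M = SO_class ?d (1\<^sub>m ?d * rotation_of M * transpose_mat (1\<^sub>m ?d))" if "size M = n" for M
    using rotation_of_carrier[of M] that by (simp add: X_def)
  moreover have "size M = n" if "M \<in> angle_multisets n s T" for M
    using that by (simp add: angle_multisets_def)
  \<comment> \<open>Both families are treated at once as classes of conjugates by some orthogonal
    \<open>P\<close>, the identity for \<open>X\<close> and \<open>F\<close> for \<open>Y\<close>;
    torsion and eigenvalue pairs are insensitive to that choice.\<close>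
  ultimately have "\<exists>M\<in>angle_multisets n s T. \<exists>P\<in>orth ?d. C = SO_class ?d (P * rotation_of M * transpose_mat P)"
    using C F(1) one_orth[of ?d] unfolding Y_def by blast
  then obtain M P where MT: "M \<in> angle_multisets n s T" and P: "P \<in> orth ?d"
    and CP: "C = SO_class ?d (P * rotation_of M * transpose_mat P)" by blast
  have M: "size M = n" "set_mset M \<subseteq> {0..1/2}" "\<forall>t\<in>#M. real m * t \<in> \<int>" "card (set_mset M) = s"
    using MT by (auto simp: angle_multisets_def T_def)
  have RSO: "rotation_of M \<in> carrier (SO ?d)" using rotation_of_SO[of M] M(1) by simp
  have R: "rotation_of M \<in> carrier_mat ?d ?d" using rotation_of_carrier[of M] M(1) by simp
  have "x [^]\<^bsub>SO ?d\<^esub> m = \<one>\<^bsub>SO ?d\<^esub> \<and> card (conj_eigenpairs x) = s" if xC: "x \<in> C" for x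
  proof -
    obtain g where g: "g \<in> orth ?d" and x: "x = g * (P * rotation_of M * transpose_mat P) * transpose_mat g"
      using xC unfolding CP by (auto simp: SO_class_def SO_iff_orth)
    have "x = (g * P) * rotation_of M * transpose_mat (g * P)"
      unfolding x by (rule conj_conj_mat[OF orthD(1)[OF g] orthD(1)[OF P] R])
    then show ?thesis
      using rotation_of_conj_torsion_iff[OF M(1,2) orth_mult[OF g P]] M(3,4) by simp
  qed
  moreover have "C \<in> conj_classes (SO ?d)"
    unfolding conj_classes_SO CP using conj_SO[OF P RSO] by blast
  ultimately show "C \<in> SO_torsion_classes n m s" by (simp add: SO_torsion_classes_def)
qed

text \<open>If the classes agreed, the characteristic polynomial would force \<open>M = N\<close>. A
  conjugator \<open>g\<close> between the two would then make \<open>g * F\<close> centralize the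
  rotation, although its determinant is -1.\<close>

lemma SO_class_chirality:
  assumes M: "size M = n" "set_mset M \<subseteq> {0..1/2}" and N: "size N = n" "set_mset N \<subseteq> {0<..<1/2}"
    and F: "F \<in> orth (2 * n)" "Determinant.det F = -1"
  shows "SO_class (2 * n) (rotation_of M) \<noteq> SO_class (2 * n) (F * rotation_of N * transpose_mat F)"
proof
  let ?d = "2 * n"
  note Fc = orthD[OF F(1)]
  have R: "rotation_of M \<in> carrier_mat ?d ?d" "rotation_of N \<in> carrier_mat ?d ?d"
    using rotation_of_carrier[of M] rotation_of_carrier[of N] M(1) N(1) by simp_all
  assume e: "SO_class ?d (rotation_of M) = SO_class ?d (F * rotation_of N * transpose_mat F)"
  have N': "set_mset N \<subseteq> {0..1/2}" using N(2) by (auto simp: less_imp_le subset_iff)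
  have MN: "M = N"
    using conj_rotation_of_inject[OF M N(1) N' one_orth F(1)] e conj_one_mat[OF R(1)] by simp
  obtain g where g: "g \<in> carrier (SO ?d)"
    and gR: "rotation_of N = g * (F * rotation_of N * transpose_mat F) * transpose_mat g"
    using SO_class_self[OF R(1)] unfolding e unfolding MN by (auto simp: SO_class_def)
  have go: "g \<in> orth ?d" "Determinant.det g = 1" using g by (auto simp: SO_iff_orth)
  have "(g * F) * rotation_of N * transpose_mat (g * F) = rotation_of N"
    using gR conj_conj_mat[OF orthD(1)[OF go(1)] Fc(1) R(2)] by simp
  then have "Determinant.det (g * F) = 1"
    by (rule rotation_of_centralizer[OF N orth_mult[OF go(1) F(1)]])
  then show False using det_orth_mult[OF go(1) F(1)] go(2) F(2) by simp
qed

text \<open>Finiteness is asserted together with the formula because \<open>card\<close> of an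
  infinite set is 0, so the equation alone would not always express a genuine count.\<close>

theorem theorem21:
  fixes n s m :: nat
  assumes "n > 0" and "s > 0" and "m > 0" and "even m"
  shows "finite (SO_torsion_classes n m s) \<and>
         N_SO n m s =
           ((n - 1) choose (s - 1)) * (((m div 2 + 1) choose s) + ((m div 2 - 1) choose s))"
proof -
  let ?d = "2 * n" and ?k = "m div 2"
  have m: "m = 2 * ?k" "0 < ?k" using assms by auto
  obtain F where F: "F \<in> orth ?d" "Determinant.det F = -1"
    using reflection_exists[of ?d] \<open>n > 0\<close> by auto
  define X where "X = (\<lambda>M. SO_class ?d (rotation_of M))"
  define Y where "Y = (\<lambda>M. SO_class ?d (F * rotation_of M * transpose_mat F))"
  define T where "T = {t \<in> {0..1/2}. real m * t \<in> \<int>}"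
  define T' where "T' = {t \<in> {0<..<1/2}. real m * t \<in> \<int>}"
  let ?M = "angle_multisets n s T" and ?M' = "angle_multisets n s T'"
  have T: "finite T" "card T = ?k + 1" "finite T'" "card T' = ?k - 1"
    using card_torsion_angles[OF m] by (simp_all add: T_def T'_def)
  have fin: "finite ?M" "finite ?M'"
    and card: "card ?M = ((?k + 1) choose s) * ((n - 1) choose (s - 1))"
      "card ?M' = ((?k - 1) choose s) * ((n - 1) choose (s - 1))"
    using multisets_with_support_card[OF T(1) \<open>n > 0\<close> \<open>s > 0\<close>]
      multisets_with_support_card[OF T(3) \<open>n > 0\<close> \<open>s > 0\<close>] T(2,4)
    by (simp_all add: angle_multisets_def)
  have M: "size M = n" "set_mset M \<subseteq> {0..1/2}" if "M \<in> ?M" for M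
    using that by (auto simp: angle_multisets_def T_def)
  have M': "size M = n" "set_mset M \<subseteq> {0<..<1/2}" "set_mset M \<subseteq> {0..1/2}" if "M \<in> ?M'" for M
    using that by (auto simp: angle_multisets_def T'_def subset_iff less_imp_le)
  have injX: "inj_on X ?M"
  proof (rule inj_onI)
    fix M N assume MN: "M \<in> ?M" "N \<in> ?M" "X M = X N"
    then show "M = N"
      using conj_rotation_of_inject[OF M[OF MN(1)] M[OF MN(2)] one_orth one_orth]
        conj_one_mat[of "rotation_of M" ?d] conj_one_mat[of "rotation_of N" ?d]
        rotation_of_carrier[of M] rotation_of_carrier[of N] M(1)[OF MN(1)] M(1)[OF MN(2)]
      by (simp add: X_def)
  qed
  have injY: "inj_on Y ?M'"
  proof (rule inj_onI)
    fix M N assume MN: "M \<in> ?M'" "N \<in> ?M'" "Y M = Y N"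
    then show "M = N"
      using conj_rotation_of_inject[OF M'(1,3)[OF MN(1)] M'(1,3)[OF MN(2)] F(1) F(1)] by (simp add: Y_def)
  qed
  have disj: "X ` ?M \<inter> Y ` ?M' = {}"
    using SO_class_chirality[OF M M'(1,2) F] by (auto simp: X_def Y_def)
  have eq: "SO_torsion_classes n m s = X ` ?M \<union> Y ` ?M'"
    unfolding X_def Y_def T_def T'_def by (rule SO_torsion_classes_eq[OF F])
  have "card (X ` ?M \<union> Y ` ?M') = card ?M + card ?M'"
    using card_Un_disjoint[OF _ _ disj] fin by (simp add: card_image injX injY)
  then show ?thesis
    unfolding N_SO_def eq using fin by (simp add: card algebra_simps)
qed

end
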